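(* Let $\mathcal{H}\subset\mathbb{F}_3^{13}$ be the ternary Hamming $[13,10,3]_3$ code. The set of maximum-weight codewords of $\mathcal{H}$ (i.e., the codewords of weight $13$, having no zero coordinate) is a completely regular code with intersection array $\{13,6,1;1,6,9\}$ in the subgraph of $H(13,3)$ induced by the set of all weight-$13$ vertices (this subgraph is isomorphic to $H(13,2)$).
   Context: The Hamming graph $H(n,q)$ has as vertices all words of length $n$ over an alphabet of size $q$ (for $q$ a prime power identified with $\mathbb{F}_q$), two words being adjacent iff they differ in exactly one position. The weight of a word is its number of nonzero symbols. The Hamming $[\frac{q^m-1}{q-1},\frac{q^m-1}{q-1}-m,3]_q$ code is the kernel of an $m\times\frac{q^m-1}{q-1}$ parity-check matrix over $\mathbb{F}_q$ whose columns are representatives, one for each, of the one-dimensional subspaces of $\mathbb{F}_q^m$ (unique up to monomial equivalence); here $q=3$, $m=3$. A partition $(C_0,\dots,C_{k-1})$ of the vertex set of a graph into nonempty sets is equitable with quotient matrix $(S_{i,j})$ if every vertex of $C_i$ has exactly $S_{i,j}$ neighbors in $C_j$ for all $i,j$. For a nonempty vertex set $C$ of a graph, let $C^{(i)}$ be the set of vertices at graph distance exactly $i$ from $C$; the covering radius $\rho$ is the largest $i$ with $C^{(i)}\neq\emptyset$. The set $C$ is a completely regular code if the distance partition $(C^{(0)},\dots,C^{(\rho)})$ is equitable. Its quotient matrix $S$ is tridiagonal, and the intersection array is $\{b_0,\dots,b_{\rho-1};c_1,\dots,c_\rho\}=\{S_{0,1},S_{1,2},\dots,S_{\rho-1,\rho};S_{1,0},S_{2,1},\dots,S_{\rho,\rho-1}\}$.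 *)

theory Defs
  imports "HOL-Analysis.Analysis"
begin

record 'v graph =
  verts :: "'v set"
  adj :: "('v \<times> 'v) set"

definition induced_subgraph :: "'v graph \<Rightarrow> 'v set \<Rightarrow> 'v graph" where
  "induced_subgraph G W = \<lparr>verts = verts G \<inter> W, adj = adj G \<inter> (W \<times> W)\<rparr>"

definition graph_isomorphic :: "'v graph \<Rightarrow> 'w graph \<Rightarrow> bool" where
  "graph_isomorphic G H \<longleftrightarrow>
     (\<exists>f. bij_betw f (verts G) (verts H) \<and>
          (\<forall>u\<in>verts G. \<forall>v\<in>verts G. (u, v) \<in> adj G \<longleftrightarrow> (f u, f v) \<in> adj H))"

text \<open>The relation power \<open>adj G ^^ n\<close> relates \<open>u\<close> to \<open>v\<close> iff there is a walk of
  length \<open>n\<close> from \<open>u\<close> to \<open>v\<close>. The infimum over the empty set is \<open>\<infinity>\<close>, the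
  distance between vertices in different components.\<close>

definition graph_dist :: "'v graph \<Rightarrow> 'v \<Rightarrow> 'v \<Rightarrow> enat" where
  "graph_dist G u v = (INF n\<in>{n. (u, v) \<in> adj G ^^ n}. enat n)"

definition dist_to_set :: "'v graph \<Rightarrow> 'v set \<Rightarrow> 'v \<Rightarrow> enat" where
  "dist_to_set G C v = (INF c\<in>C. graph_dist G c v)"

definition dist_layer :: "'v graph \<Rightarrow> 'v set \<Rightarrow> nat \<Rightarrow> 'v set" where
  "dist_layer G C i = {v \<in> verts G. dist_to_set G C v = enat i}"

text \<open>Only meaningful if \<open>C\<close> is nonempty and the graph is finite; otherwise the
  argument of \<^const>\<open>Max\<close> may be empty or infinite.\<close>

definition covering_radius :: "'v graph \<Rightarrow> 'v set \<Rightarrow> nat" where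
  "covering_radius G C = Max {i. dist_layer G C i \<noteq> {}}"

text \<open>The cells are \<open>P 0, \<dots>, P (k - 1)\<close>; \<open>P\<close> and \<open>S\<close> are irrelevant outside
  the index range.\<close>

definition equitable_partition ::
  "'v graph \<Rightarrow> nat \<Rightarrow> (nat \<Rightarrow> 'v set) \<Rightarrow> (nat \<Rightarrow> nat \<Rightarrow> nat) \<Rightarrow> bool" where
  "equitable_partition G k P S \<longleftrightarrow>
     (\<Union>i<k. P i) = verts G \<and>
     disjoint_family_on P {..<k} \<and>
     (\<forall>i<k. P i \<noteq> {}) \<and>
     (\<forall>i<k. \<forall>j<k. \<forall>v\<in>P i. card {w \<in> P j. (v, w) \<in> adj G} = S i j)"

definition completely_regular_code :: "'v graph \<Rightarrow> 'v set \<Rightarrow> bool" where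
  "completely_regular_code G C \<longleftrightarrow>
     C \<noteq> {} \<and> C \<subseteq> verts G \<and>
     (\<exists>S. equitable_partition G (Suc (covering_radius G C)) (dist_layer G C) S)"

text \<open>The lists are \<open>[b\<^sub>0, \<dots>, b\<^bsub>\<rho>-1\<^esub>]\<close> and \<open>[c\<^sub>1, \<dots>, c\<^bsub>\<rho>\<^esub>]\<close>.
  As all cells are nonempty, the quotient matrix \<open>S\<close> is uniquely determined on the relevant
  indices.\<close>

definition has_intersection_array :: "'v graph \<Rightarrow> 'v set \<Rightarrow> nat list \<Rightarrow> nat list \<Rightarrow> bool" where
  "has_intersection_array G C bs cs \<longleftrightarrow>
     (let \<rho> = covering_radius G C in
      \<exists>S. equitable_partition G (Suc \<rho>) (dist_layer G C) S \<and>
          bs = map (\<lambda>i. S i (i + 1)) [0..<\<rho>] \<and>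
          cs = map (\<lambda>i. S i (i - 1)) [1..<\<rho> + 1])"

text \<open>Words of length \<open>n\<close> over an alphabet of size \<open>q\<close> are the elements of
  \<open>'a ^ 'n\<close> with \<open>CARD('n) = n\<close> and \<open>CARD('a) = q\<close>.\<close>

definition hamming_graph :: "('a ^ 'n) graph" where
  "hamming_graph = \<lparr>verts = UNIV, adj = {(x, y). card {i. x $ i \<noteq> y $ i} = 1}\<rparr>"

definition weight :: "'a::zero ^ 'n \<Rightarrow> nat" where
  "weight x = card {i. x $ i \<noteq> 0}"

text \<open>The columns of \<open>A\<close> represent every one-dimensional subspace exactly once; over a finite
  field with \<open>q\<close> elements this forces \<open>CARD('n) = (q ^ m - 1) / (q - 1)\<close> for
  \<open>m = CARD('m)\<close>.\<close>

definition hamming_parity_check :: "'a::field ^ 'n ^ 'm \<Rightarrow> bool" where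
  "hamming_parity_check A \<longleftrightarrow>
     bij_betw (\<lambda>j. vec.span {column j A}) UNIV {U. vec.subspace U \<and> vec.dim U = 1}"

definition code_of_parity_check :: "'a::field ^ 'n ^ 'm \<Rightarrow> ('a ^ 'n) set" where
  "code_of_parity_check A = {x. A *v x = 0}"

end

theory Submission
  imports Defs
begin

text \<open>
  Let \<open>V\<close> be the space of syndromes \<open>'a ^ 3\<close>, which has 27 elements. All coordinates of a word
  \<open>x\<close> of full weight are \<open>1\<close> or \<open>-1\<close>, and the columns of the parity-check matrix represent each pair
  \<open>{v, -v}\<close> of nonzero vectors once. Hence the scaled columns \<open>x\<^sub>j a\<^sub>j\<close> form a set \<open>D\<close> that contains exactly
  one vector of each of the 13 pairs (a half set), and every half set arises from a unique \<open>x\<close>. The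
  syndrome of \<open>x\<close> is \<open>s = \<Sum>D\<close>. The neighbours of \<open>x\<close> of full weight are obtained by negating
  one coordinate; this replaces one \<open>d \<in> D\<close> by \<open>-d\<close>, and \<open>s\<close> by \<open>s - 2d = s + d\<close>. The theorem thus
  becomes a statement about half sets.

  The distance of \<open>x\<close> from the code turns out to be the following level of \<open>D\<close>. It is 0 if \<open>s = 0\<close>,
  and 1 if \<open>-s \<in> D\<close>. Otherwise \<open>s \<in> D\<close>, and the level is 3 if \<open>D - {s}\<close> is a union of cosets of
  \<open>{0, s, -s}\<close> and 2 if it is not. A general lemma
  (\<open>tridiagonal_equitable_partition_is_distance_partition\<close>) says that an equitable partition whose
  quotient matrix has the tridiagonal shape of an intersection array is the distance partition of its
  first cell. So it suffices to count, for a half set of level \<open>i\<close>, the \<open>d \<in> D\<close> whose flip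
  leads to level \<open>j\<close>.

  \<^item> Level 0 is reached only by \<open>d = -s\<close>. If \<open>s = 0\<close>, the new sum is \<open>d\<close> and \<open>-d\<close> is in the new set, so
    all 13 neighbours have level 1.

  \<^item> For \<open>s \<noteq> 0\<close>, level 1 is reached by the breaks: the \<open>d \<in> D\<close> other than \<open>s\<close> and \<open>-s\<close> with
    \<open>d + s \<notin> D\<close>. A coset of \<open>{0, s, -s}\<close> is a row of three signs, which tell for each of its
    elements \<open>v\<close> whether \<open>v\<close> or \<open>-v\<close> is in \<open>D\<close>. The breaks correspond to the rows that are not
    constant, that is, to the rows with a nonzero sum modulo 3. Up to sign there are four rows besides
    \<open>{0, s, -s}\<close>, and \<open>\<Sum>D = s\<close> forces their four sums to form a word of the tetracode, whose
    nonzero words have weight 3. So there are 0 or 6 breaks; and with 0 breaks one finds \<open>s \<in> D\<close>.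

  \<^item> A flip at \<open>d \<noteq> s\<close> can reach level 3 only if the whole coset \<open>d + {0, s, -s}\<close> lies in \<open>D\<close>. At level 2,
    there is one such coset; outside the plane that it spans with \<open>s\<close>, the three rows of an affine plane have
    one minority sign each, in three positions that sum to zero and therefore form a line. The only \<open>d\<close>
    in the coset that works is the one for which \<open>s + d\<close> is a direction of this line. At level 3, a
    suitable basis \<open>s, b, c\<close> turns \<open>D\<close> into the set of vectors whose last nonzero coordinate
    is \<open>1\<close>, where \<open>d = s\<close> and the three \<open>d \<in> b + {0, s, -s}\<close> work.

  As \<open>D\<close> has 13 elements, subtraction gives the other entries of the quotient matrix.
\<close>

section \<open>Distance partitions from quotient matrices\<close>

lemma walk_rank_le:
  fixes r :: "'v \<Rightarrow> nat"
  assumes "\<And>u v. (u, v) \<in> adj G \<Longrightarrow> r v \<le> Suc (r u)"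
  shows "(u, v) \<in> adj G ^^ n \<Longrightarrow> r v \<le> r u + n"
proof (induction n arbitrary: v)
  case (Suc n)
  then obtain w where "(u, w) \<in> adj G ^^ n" "(w, v) \<in> adj G" by auto
  with Suc.IH assms show ?case by fastforce
qed simp

lemma walk_from_rank_zero:
  fixes r :: "'v \<Rightarrow> nat"
  assumes down: "\<And>v. v \<in> V \<Longrightarrow> r v \<noteq> 0 \<Longrightarrow> \<exists>u\<in>V. (u, v) \<in> adj G \<and> Suc (r u) = r v"
  shows "v \<in> V \<Longrightarrow> \<exists>c\<in>V. r c = 0 \<and> (c, v) \<in> adj G ^^ r v"
proof (induction "r v" arbitrary: v)
  case 0
  then show ?case by (metis relpow_0_I)
next
  case (Suc n)
  from Suc.hyps(2) Suc.prems down obtain u where u: "u \<in> V" "(u, v) \<in> adj G" "Suc (r u) = r v"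
    by (metis nat.distinct(1))
  with Suc.hyps have "n = r u" by simp
  with Suc.hyps(1) u obtain c where "c \<in> V" "r c = 0" "(c, u) \<in> adj G ^^ r u" by blast
  with u show ?case by (metis relpow_Suc_I)
qed

text \<open>A rank that grows by at most one along an edge bounds the length of all walks from rank zero from
  below, and descending step by step yields a walk that attains the bound.\<close>

lemma dist_to_set_eq_rank:
  fixes r :: "'v \<Rightarrow> nat"
  assumes up: "\<And>u v. (u, v) \<in> adj G \<Longrightarrow> r v \<le> Suc (r u)"
    and down: "\<And>v. v \<in> verts G \<Longrightarrow> r v \<noteq> 0 \<Longrightarrow>
      \<exists>u\<in>verts G. (u, v) \<in> adj G \<and> Suc (r u) = r v"
    and v: "v \<in> verts G"
  shows "dist_to_set G {v \<in> verts G. r v = 0} v = enat (r v)"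
proof (rule antisym)
  obtain c where "c \<in> verts G" "r c = 0" "(c, v) \<in> adj G ^^ r v"
    using walk_from_rank_zero[OF down v] by blast
  then show "dist_to_set G {v \<in> verts G. r v = 0} v \<le> enat (r v)"
    unfolding dist_to_set_def graph_dist_def
    by (intro INF_lower2[of c] INF_lower2[of "r v"]) auto
next
  show "enat (r v) \<le> dist_to_set G {v \<in> verts G. r v = 0} v"
    unfolding dist_to_set_def graph_dist_def
    using walk_rank_le[OF up] by (fastforce intro!: INF_greatest)
qed

text \<open>The zeros above the superdiagonal make the cell index \<open>r\<close> grow by at most one along an edge, and
  the nonzero subdiagonal allows to descend, so \<open>r\<close> is the distance from \<open>C\<close>. As the superdiagonal has
  no zero either, one can ascend to the last cell, and no cell is empty.\<close>

theorem tridiagonal_equitable_partition_is_distance_partition: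
  fixes r :: "'v \<Rightarrow> nat" and S :: "nat \<Rightarrow> nat \<Rightarrow> nat"
  assumes fin: "finite (verts G)" and ne: "verts G \<noteq> {}"
    and adj: "adj G \<subseteq> verts G \<times> verts G" "sym (adj G)"
    and r_le: "\<And>v. v \<in> verts G \<Longrightarrow> r v \<le> \<rho>"
    and S: "\<And>v j. v \<in> verts G \<Longrightarrow> j \<le> \<rho> \<Longrightarrow> card {w \<in> verts G. r w = j \<and> (v, w) \<in> adj G} = S (r v) j"
    and S_far: "\<And>i j. i \<le> \<rho> \<Longrightarrow> j \<le> \<rho> \<Longrightarrow> Suc i < j \<Longrightarrow> S i j = 0"
    and S_up: "\<And>i. i < \<rho> \<Longrightarrow> S i (Suc i) \<noteq> 0"
    and S_down: "\<And>i. i < \<rho> \<Longrightarrow> S (Suc i) i \<noteq> 0"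
    and C: "C = {v \<in> verts G. r v = 0}"
  shows "completely_regular_code G C"
    and "has_intersection_array G C (map (\<lambda>i. S i (i + 1)) [0..<\<rho>]) (map (\<lambda>i. S i (i - 1)) [1..<\<rho> + 1])"
proof -
  have nbr: "\<exists>w\<in>verts G. r w = j \<and> (v, w) \<in> adj G" if "v \<in> verts G" "j \<le> \<rho>" "S (r v) j \<noteq> 0" for v j
  proof (rule ccontr)
    assume "\<not> ?thesis"
    then have "{w \<in> verts G. r w = j \<and> (v, w) \<in> adj G} = {}" by blast
    then have "S (r v) j = 0" using S[OF that(1,2)] by (metis card.empty)
    then show False using that(3) by contradiction
  qed
  have up: "r v \<le> Suc (r u)" if uv: "(u, v) \<in> adj G" for u v
  proof (rule ccontr)
    assume "\<not> ?thesis"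
    moreover have V: "u \<in> verts G" "v \<in> verts G" using uv adj(1) by auto
    ultimately have "card {w \<in> verts G. r w = r v \<and> (u, w) \<in> adj G} = 0"
      using S[of u "r v"] S_far[of "r u" "r v"] r_le by simp
    then have "{w \<in> verts G. r w = r v \<and> (u, w) \<in> adj G} = {}"
      using fin by simp
    then show False using uv V by blast
  qed
  have down: "\<exists>u\<in>verts G. (u, v) \<in> adj G \<and> Suc (r u) = r v" if v: "v \<in> verts G" "r v \<noteq> 0" for v
  proof -
    obtain i where i: "r v = Suc i" using v(2) by (cases "r v") auto
    then have "i < \<rho>" using r_le[OF v(1)] by simp
    then obtain u where "u \<in> verts G" "r u = i" "(v, u) \<in> adj G"
      using nbr[OF v(1), of i] S_down[of i] i by auto
    then show ?thesis using adj(2) i by (auto dest: symD)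
  qed
  have layer: "dist_layer G C i = {v \<in> verts G. r v = i}" for i
    unfolding dist_layer_def C using dist_to_set_eq_rank[of G r, OF up down] by auto
  have nonempty: "{v \<in> verts G. r v = i} \<noteq> {}" if "i \<le> \<rho>" for i
    using that
  proof (induction i)
    case 0
    show ?case using ne walk_from_rank_zero[of "verts G" r, OF down] by blast
  next
    case (Suc i)
    then obtain v where "v \<in> verts G" "r v = i" by auto
    then show ?case using nbr[of v "Suc i"] S_up[of i] Suc.prems by auto
  qed
  have "{i. dist_layer G C i \<noteq> {}} = {..\<rho>}"
    using nonempty r_le by (auto simp: layer)
  then have radius: "covering_radius G C = \<rho>"
    unfolding covering_radius_def by (auto intro!: Max_eqI)
  have "equitable_partition G (Suc \<rho>) (dist_layer G C) S"
    unfolding equitable_partition_def layer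
    using r_le nonempty S by (auto simp: disjoint_family_on_def less_Suc_eq_le conj_assoc)
  then show "completely_regular_code G C"
    "has_intersection_array G C (map (\<lambda>i. S i (i + 1)) [0..<\<rho>]) (map (\<lambda>i. S i (i - 1)) [1..<\<rho> + 1])"
    unfolding completely_regular_code_def has_intersection_array_def radius Let_def
    using nonempty[of 0] by (auto simp: C)
qed

section \<open>The field with three elements\<close>

locale ternary_field =
  fixes ty :: "'a::field itself"
  assumes card3: "CARD('a) = 3"
begin

lemma finite_F3: "finite (UNIV :: 'a set)"
  using card3 by (simp add: card_ge_0_finite)

lemma three_F3: "(3 :: 'a) = 0"
proof -
  \<comment> \<open>Translation by 1 permutes the field but adds \<open>CARD('a)\<close> to the sum of all elements.\<close>
  have "(\<Sum>x\<in>(UNIV::'a set). x) = (\<Sum>x\<in>UNIV. x + 1)"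
    by (rule sum.reindex_bij_witness[where i = "\<lambda>x. x + 1" and j = "\<lambda>x. x - 1"]) auto
  then show ?thesis
    by (simp add: sum.distrib card3)
qed

lemma two_F3: "(2 :: 'a) = -1"
  using three_F3 by (metis add.commute add_eq_0_iff numeral_plus_one semiring_norm(5))

lemma one_neq_minus_one_F3: "(1 :: 'a) \<noteq> -1" "(-1 :: 'a) \<noteq> 1"
  using two_F3 by (metis add_eq_0_iff one_add_one neg_equal_0_iff_equal zero_neq_one)+

lemma F3_simps: "(2 :: 'a) = -1" "(3 :: 'a) = 0" "(1 :: 'a) \<noteq> -1" "(-1 :: 'a) \<noteq> 1"
  using two_F3 three_F3 one_neq_minus_one_F3 by auto

lemma UNIV_F3: "(UNIV :: 'a set) = {0, 1, -1}"
proof -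
  have "card {0, 1, -1 :: 'a} = 3" using one_neq_minus_one_F3 by simp
  then show ?thesis using card3 finite_F3 by (metis card_subset_eq subset_UNIV)
qed

lemma F3_cases: "(x :: 'a) = 0 \<or> x = 1 \<or> x = -1"
  using UNIV_F3 by blast

lemma sum_F3: "(\<Sum>x\<in>UNIV. h x) = h (0 :: 'a) + h 1 + h (-1)"
  using one_neq_minus_one_F3 by (simp add: UNIV_F3 add_ac)

lemma F3_triple: "x + x + x = (0::'a)"
  using F3_cases[of x] three_F3 by (auto simp: algebra_simps)

lemma vec_triple: "v + v = - (v :: 'a ^ 'n)"
  by (simp add: vec_eq_iff eq_neg_iff_add_eq_0 F3_triple three_F3)

end

section \<open>Half sets and their levels\<close>

text \<open>Over the field with three elements, these are the sets that contain exactly one nonzero vector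
  of each one-dimensional subspace.\<close>

definition half_set :: "'v::ab_group_add set \<Rightarrow> bool" where
  "half_set D \<longleftrightarrow> 0 \<notin> D \<and> (\<forall>v. v \<noteq> 0 \<longrightarrow> (-v \<in> D \<longleftrightarrow> v \<notin> D))"

definition flip :: "'v::ab_group_add \<Rightarrow> 'v set \<Rightarrow> 'v set" where
  "flip d D = insert (-d) (D - {d})"

text \<open>The elements that stop \<open>D\<close> from being closed under translation by \<open>s\<close>. The line of \<open>s\<close> is left out:
  for a half set it contains an element at which closure fails for a trivial reason.\<close>

definition breaks :: "'v::ab_group_add set \<Rightarrow> 'v \<Rightarrow> 'v set" where
  "breaks D s = {v \<in> D. v \<noteq> s \<and> v \<noteq> -s \<and> v + s \<notin> D}"

text \<open>The distance from the code, read off from the half set of a word.\<close>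

definition level :: "'v::ab_group_add set \<Rightarrow> nat" where
  "level D =
    (if \<Sum>D = 0 then 0 else if - \<Sum>D \<in> D then 1 else if breaks D (\<Sum>D) = {} then 3 else 2)"

lemma half_set_0: "half_set D \<Longrightarrow> 0 \<notin> D"
  by (simp add: half_set_def)

lemma half_set_uminus: "half_set D \<Longrightarrow> v \<noteq> 0 \<Longrightarrow> -v \<in> D \<longleftrightarrow> v \<notin> D"
  by (simp add: half_set_def)

lemma mem_flip: "v \<in> flip d D \<longleftrightarrow> v = -d \<or> v \<in> D \<and> v \<noteq> d"
  by (auto simp: flip_def)

lemma level_le: "level D \<le> 3"
  by (simp add: level_def)

context ternary_field
begin

lemma card_space: "CARD('a ^ 3) = 27"
  by (simp add: card3)

lemma finite_space [simp]: "finite (D :: ('a ^ 3) set)"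
  by (rule finite_subset[OF subset_UNIV]) (use card_space in \<open>simp add: card_ge_0_finite\<close>)

lemma eq_uminus_iff: "v = -v \<longleftrightarrow> (v :: 'a ^ 'n) = 0"
  by (metis add_cancel_right_left add.inverse_neutral vec_triple)

lemma half_set_flip:
  fixes D :: "('a ^ 3) set"
  assumes "half_set D" "d \<in> D"
  shows "half_set (flip d D)"
proof -
  have d: "d \<noteq> 0" using assms half_set_0 by metis
  have "-v \<in> flip d D \<longleftrightarrow> v \<notin> flip d D" if "v \<noteq> 0" for v
  proof (cases "v = d \<or> v = -d")
    case True
    then show ?thesis using d eq_uminus_iff[of d] by (auto simp: mem_flip)
  next
    case False
    then have "-v \<noteq> d" by (metis add.inverse_inverse)
    then show ?thesis using False half_set_uminus[OF assms(1) that] by (simp add: mem_flip)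
  qed
  then show ?thesis
    using d half_set_0[OF assms(1)] by (simp add: half_set_def mem_flip)
qed

lemma sum_flip:
  fixes D :: "('a ^ 3) set"
  assumes "half_set D" "d \<in> D"
  shows "\<Sum>(flip d D) = \<Sum>D + d"
proof -
  have "-d \<notin> D" using assms half_set_uminus half_set_0 by metis
  then have "\<Sum>(flip d D) = -d + (\<Sum>D - d)"
    unfolding flip_def using assms(2) by (simp add: sum_diff1)
  then show ?thesis using vec_triple[of d] by (simp add: algebra_simps)
qed

lemma card_half_set:
  fixes D :: "('a ^ 3) set"
  assumes "half_set D"
  shows "card D = 13"
proof -
  \<comment> \<open>The 27 vectors are 0, those in \<open>D\<close> and their negatives.\<close>
  have "UNIV = insert 0 (D \<union> uminus ` D)"
    using assms unfolding half_set_def by (auto simp: image_iff) (metis add.inverse_inverse)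
  moreover have "D \<inter> uminus ` D = {}" "0 \<notin> D \<union> uminus ` D"
    using assms unfolding half_set_def by (auto simp: image_iff) metis
  moreover have "card (uminus ` D) = card D"
    by (rule card_image) simp
  ultimately have "27 = Suc (card D + card D)"
    using card_space by (metis card_Un_disjoint card_insert_disjoint finite_space)
  then show ?thesis by simp
qed

lemma level_flip_eq_0_iff:
  fixes D :: "('a ^ 3) set"
  assumes "half_set D" "d \<in> D"
  shows "level (flip d D) = 0 \<longleftrightarrow> d = - \<Sum>D"
  using sum_flip[OF assms] by (simp add: level_def add_eq_0_iff)

text \<open>The new sum is \<open>s + d\<close>, and level 1 asks for its negative in the new set. As a half set contains
  one of \<open>s + d\<close> and \<open>-(s + d)\<close>, this is a condition on \<open>s + d\<close>.\<close>

lemma level_flip_eq_1_iff: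
  fixes D :: "('a ^ 3) set"
  assumes D: "half_set D" "d \<in> D" and s: "\<Sum>D \<noteq> 0"
  shows "level (flip d D) = 1 \<longleftrightarrow> d \<in> breaks D (\<Sum>D)"
proof -
  let ?s = "\<Sum>D"
  have "level (flip d D) = 1 \<longleftrightarrow> ?s + d \<noteq> 0 \<and> -(?s + d) \<in> flip d D"
    using sum_flip[OF D] by (simp add: level_def)
  also have "\<dots> \<longleftrightarrow> ?s + d \<noteq> 0 \<and> -(?s + d) \<noteq> d \<and> ?s + d \<notin> D"
    using s half_set_uminus[OF D(1), of "?s + d"] by (auto simp: mem_flip)
  also have "-(?s + d) = d \<longleftrightarrow> d = ?s"
    using vec_triple[of d] by (metis add_right_imp_eq minus_minus)
  also have "?s + d \<noteq> 0 \<and> d \<noteq> ?s \<and> ?s + d \<notin> D \<longleftrightarrow> d \<in> breaks D ?s"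
    using D(2) by (auto simp: breaks_def add_eq_0_iff add.commute)
  finally show ?thesis .
qed

lemma level_flip_eq_3_iff:
  fixes D :: "('a ^ 3) set"
  assumes D: "half_set D" "d \<in> D"
  shows "level (flip d D) = 3 \<longleftrightarrow>
    \<Sum>D + d \<in> flip d D \<and> (\<forall>v\<in>flip d D. v \<noteq> \<Sum>D + d \<longrightarrow> v + (\<Sum>D + d) \<in> flip d D)"
  (is "_ \<longleftrightarrow> ?t \<in> ?E \<and> _")
proof -
  have E: "half_set ?E" using half_set_flip[OF D] .
  have *: "?t \<in> ?E \<longleftrightarrow> ?t \<noteq> 0 \<and> -?t \<notin> ?E"
    using half_set_uminus[OF E, of ?t] half_set_0[OF E] by (cases "?t = 0") auto
  show ?thesis
    unfolding level_def sum_flip[OF D] breaks_def * by auto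
qed

text \<open>The flipped set still contains \<open>-s\<close>. At level 3 it would be closed under translation by the new sum
  \<open>s + d\<close>, which takes \<open>-s\<close> to the removed element \<open>d\<close>.\<close>

lemma no_level_3_next_to_level_1:
  fixes D :: "('a ^ 3) set"
  assumes D: "half_set D" "d \<in> D" and s: "- \<Sum>D \<in> D"
  shows "level (flip d D) \<noteq> 3"
proof
  let ?s = "\<Sum>D"
  assume l: "level (flip d D) = 3"
  have d0: "d \<noteq> 0" and s0: "?s \<noteq> 0" using D s half_set_0 by fastforce+
  then have d: "d \<noteq> - ?s" using l level_flip_eq_0_iff[OF D] by auto
  have "-?s \<in> flip d D" using s d by (simp add: mem_flip)
  moreover have "-?s \<noteq> ?s + d"
  proof
    assume "-?s = ?s + d"
    then have "?s + d = ?s + ?s" by (simp add: vec_triple)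
    then have "?s = d" by simp
    then show False using D s half_set_uminus[OF D(1) s0] by simp
  qed
  ultimately have "d \<in> flip d D"
    using l level_flip_eq_3_iff[OF D] by fastforce
  then show False using d0 by (simp add: mem_flip eq_uminus_iff)
qed

end

section \<open>Coordinates and rows\<close>

definition point :: "'a::field ^ 'n \<Rightarrow> 'a ^ 'n \<Rightarrow> 'a ^ 'n \<Rightarrow> 'a \<Rightarrow> 'a \<Rightarrow> 'a \<Rightarrow> 'a ^ 'n" where
  "point s b c i j k = i *s s + j *s b + k *s c"

text \<open>In a space of dimension three, this says that \<open>s, b, c\<close> is a basis.\<close>

definition frame :: "'a::field ^ 'n \<Rightarrow> 'a ^ 'n \<Rightarrow> 'a ^ 'n \<Rightarrow> bool" where
  "frame s b c \<longleftrightarrow> (\<forall>i j k. point s b c i j k = 0 \<longrightarrow> i = 0 \<and> j = 0 \<and> k = 0)"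

lemma point_add: "point s b c i j k + point s b c i' j' k' = point s b c (i + i') (j + j') (k + k')"
  by (simp add: point_def vec.scale_left_distrib)

lemma point_uminus: "- point s b c i j k = point s b c (-i) (-j) (-k)"
  by (simp add: point_def vec.scale_minus_left)

lemma point_eq_iff:
  assumes "frame s b c"
  shows "point s b c i j k = point s b c i' j' k' \<longleftrightarrow> i = i' \<and> j = j' \<and> k = k'"
proof
  assume "point s b c i j k = point s b c i' j' k'"
  then have "point s b c i j k + - point s b c i' j' k' = 0" by simp
  then have "point s b c (i - i') (j - j') (k - k') = 0"
    by (simp only: point_uminus point_add diff_conv_add_uminus)
  then have "i - i' = 0 \<and> j - j' = 0 \<and> k - k' = 0" using assms unfolding frame_def by blast
  then show "i = i' \<and> j = j' \<and> k = k'" by simp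
qed simp

lemma frame_swap:
  assumes "frame s b c"
  shows "frame s c b"
proof -
  have "point s c b i j k = point s b c i k j" for i j k
    by (simp add: point_def add_ac)
  then show ?thesis using assms unfolding frame_def by auto
qed

lemma frame_shear: "frame s b c \<Longrightarrow> frame s (b + x *s c) c"
  unfolding frame_def
proof (intro allI impI)
  fix i j k
  assume "\<forall>i j k. point s b c i j k = 0 \<longrightarrow> i = 0 \<and> j = 0 \<and> k = 0" "point s (b + x *s c) c i j k = 0"
  moreover have "point s (b + x *s c) c i j k = point s b c i j (j * x + k)"
    by (simp add: point_def vec.scale_right_distrib vec.scale_left_distrib add_ac)
  ultimately have "i = 0 \<and> j = 0 \<and> j * x + k = 0" by metis
  then show "i = 0 \<and> j = 0 \<and> k = 0" by auto
qed

lemma frame_scale: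
  assumes "frame s b c" "x \<noteq> 0" "y \<noteq> 0"
  shows "frame s (x *s b) (y *s c)"
proof -
  have "point s (x *s b) (y *s c) i j k = point s b c i (j * x) (k * y)" for i j k
    by (simp add: point_def)
  then show ?thesis using assms unfolding frame_def by fastforce
qed

context ternary_field
begin

lemma frame_exists:
  fixes s b :: "'a ^ 3"
  assumes "s \<noteq> 0" "b \<noteq> 0" "b \<noteq> s" "b \<noteq> -s"
  obtains c where "frame s b c"
proof -
  \<comment> \<open>The combinations of \<open>s\<close> and \<open>b\<close> are at most 9 of the 27 vectors; any other vector will do for \<open>c\<close>.\<close>
  let ?P = "(\<lambda>(i, j). i *s s + j *s b) ` (UNIV \<times> UNIV)"
  have "card ?P \<le> card ((UNIV :: 'a set) \<times> (UNIV :: 'a set))"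
    by (rule card_image_le) (simp add: finite_F3 flip: UNIV_Times_UNIV)
  also have "\<dots> < card (UNIV :: ('a ^ 3) set)"
    by (simp add: card3 card_cartesian_product del: UNIV_Times_UNIV)
  finally obtain c where c: "c \<notin> ?P" by (metis UNIV_eq_I less_irrefl)
  have "frame s b c"
    unfolding frame_def
  proof (intro allI impI)
    fix i j k
    assume *: "point s b c i j k = 0"
    have k: "k = 0"
    proof (rule ccontr)
      assume "k \<noteq> 0"
      have "k *s c = - (i *s s + j *s b)"
        using * unfolding point_def by (metis add.commute add_eq_0_iff)
      then have "(1 / k) *s (k *s c) = (1 / k) *s (- (i *s s + j *s b))" by simp
      then have "c = (- i / k) *s s + (- j / k) *s b"
        using \<open>k \<noteq> 0\<close> by (simp add: vec.scale_right_diff_distrib vec.scale_minus_left)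
      then show False using c by (metis (mono_tags, lifting) SigmaI UNIV_I image_eqI split_conv)
    qed
    have j: "j = 0"
    proof (rule ccontr)
      assume "j \<noteq> 0"
      have "j *s b = (- i) *s s"
        using * k unfolding point_def by (simp add: add_eq_0_iff vec.scale_minus_left)
      then have "(1 / j) *s (j *s b) = (1 / j) *s ((- i) *s s)" by simp
      then obtain x where "b = x *s s"
        using \<open>j \<noteq> 0\<close> by (metis nonzero_divide_eq_eq vec.scale_one vec.scale_scale)
      then show False using F3_cases[of x] assms by (auto simp: vec.scale_minus_left)
    qed
    show "i = 0 \<and> j = 0 \<and> k = 0"
      using * k j assms(1) by (simp add: point_def)
  qed
  then show thesis by (rule that)
qed

lemma frame_surj:
  fixes s b c :: "'a ^ 3"
  assumes "frame s b c"
  shows "bij (\<lambda>(i, j, k). point s b c i j k)"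
proof -
  have inj: "inj (\<lambda>(i, j, k). point s b c i j k)"
    using point_eq_iff[OF assms] by (auto intro!: injI)
  have "card (range (\<lambda>(i, j, k). point s b c i j k)) = card (UNIV :: ('a \<times> 'a \<times> 'a) set)"
    using inj by (rule card_image)
  also have "\<dots> = card (UNIV :: ('a ^ 3) set)"
    by (simp add: card3 card_cartesian_product flip: UNIV_Times_UNIV)
  finally have "range (\<lambda>(i, j, k). point s b c i j k) = UNIV"
    by (metis card_subset_eq finite_space subset_UNIV)
  then show ?thesis using inj by (simp add: bij_def)
qed

text \<open>A cyclic sequence of three signs has exactly one step from \<open>1\<close> to \<open>-1\<close> unless it is constant, and it
  is constant iff its sum vanishes modulo 3.\<close>

lemma row_breaks:
  fixes r :: "'a \<Rightarrow> 'a"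
  assumes "\<And>i. r i = 1 \<or> r i = -1"
  shows "(\<Sum>i\<in>UNIV. of_bool (r i = 1 \<and> r (i + 1) \<noteq> 1)) = (of_bool ((\<Sum>i\<in>UNIV. r i) \<noteq> 0) :: nat)"
  using assms[of 0] assms[of 1] assms[of "-1"]
  by (auto simp: sum_F3 F3_simps)

lemma row_constant:
  fixes r :: "'a \<Rightarrow> 'a"
  assumes "\<And>i. r i = 1 \<or> r i = -1"
  shows "(\<Sum>i\<in>UNIV. r i) = 0 \<longleftrightarrow> (\<forall>i. r i = r 0)"
proof -
  have "(\<forall>i. r i = r 0) \<longleftrightarrow> r 1 = r 0 \<and> r (-1) = r 0" using F3_cases by metis
  then show ?thesis
    using assms[of 0] assms[of 1] assms[of "-1"] by (auto simp: sum_F3 F3_simps)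
qed

text \<open>In a row that is not constant, one sign differs from the two others, whose common value is the sum
  of the row modulo 3. The difference \<open>r 1 - r (-1)\<close> is the first moment
  \<open>\<Sum>i. i * r i\<close>, which locates the odd one out.\<close>

lemma row_minority:
  fixes r :: "'a \<Rightarrow> 'a"
  assumes "\<And>i. r i = 1 \<or> r i = -1" and g: "(\<Sum>i\<in>UNIV. r i) = g" "g \<noteq> 0"
  obtains m where "\<And>i. r i = (if i = m then -g else g)" and "r 1 - r (-1) = g * m"
proof -
  have "(r 0 = -g \<and> r 1 = g \<and> r (-1) = g) \<or> (r 0 = g \<and> r 1 = -g \<and> r (-1) = g) \<or> (r 0 = g \<and> r 1 = g \<and> r (-1) = -g)"
    using assms(1)[of 0] assms(1)[of 1] assms(1)[of "-1"] g
    by (auto simp: sum_F3 F3_simps)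
  moreover have "g + g = - g" using F3_triple[of g] by (simp add: eq_neg_iff_add_eq_0)
  ultimately consider
      "\<forall>i\<in>{0, 1, -1}. r i = (if i = 0 then -g else g)" "r 1 - r (-1) = g * 0"
    | "\<forall>i\<in>{0, 1, -1}. r i = (if i = 1 then -g else g)" "r 1 - r (-1) = g * 1"
    | "\<forall>i\<in>{0, 1, -1}. r i = (if i = -1 then -g else g)" "r 1 - r (-1) = g * (-1)"
    by (force simp: F3_simps algebra_simps)
  then show thesis
    by cases (use that UNIV_F3 in \<open>metis UNIV_I\<close>)+
qed

text \<open>The two equations are parity checks of the tetracode, the ternary code of length 4,
  dimension 2 and minimum distance 3. Its nonzero words all have weight 3.\<close>

lemma tetracode_weight:
  fixes p q r t :: 'a
  assumes "q + r + t = 0" "p + r - t = 0"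
  shows "of_bool (p \<noteq> 0) + of_bool (q \<noteq> 0) + of_bool (r \<noteq> 0) + of_bool (t \<noteq> 0) \<in> {0, 3 :: nat}"
proof -
  have "q = - r - t" "p = t - r" using assms by (auto simp: algebra_simps eq_neg_iff_add_eq_0)
  then show ?thesis using F3_cases[of r] F3_cases[of t] by (auto simp: F3_simps)
qed

end

text \<open>The first basis vector is the sum of the half set, so that the rows of constant \<open>j\<close> and \<open>k\<close>
  are the cosets of \<open>{0, s, -s}\<close>.\<close>

locale framed_half_set = ternary_field ty for ty :: "'a::field itself" +
  fixes D :: "('a ^ 3) set" and s b c :: "'a ^ 3"
  assumes half: "half_set D" and frame: "frame s b c" and sum_D: "\<Sum>D = s"
begin

abbreviation pt :: "'a \<Rightarrow> 'a \<Rightarrow> 'a \<Rightarrow> 'a ^ 3" where "pt \<equiv> point s b c"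

text \<open>The value 0 at the origin makes this function odd.\<close>

definition side :: "'a \<Rightarrow> 'a \<Rightarrow> 'a \<Rightarrow> 'a" where
  "side i j k = (if i = 0 \<and> j = 0 \<and> k = 0 then 0 else if pt i j k \<in> D then 1 else -1)"

definition row :: "'a \<Rightarrow> 'a \<Rightarrow> 'a" where
  "row j k = (\<Sum>i\<in>UNIV. side i j k)"

lemma pt_eq_iff: "pt i j k = pt i' j' k' \<longleftrightarrow> i = i' \<and> j = j' \<and> k = k'"
  by (rule point_eq_iff[OF frame])

lemma pt_0: "pt 0 0 0 = 0" and pt_s: "pt 1 0 0 = s"
  by (simp_all add: point_def)

lemma mem_iff: "pt i j k \<in> D \<longleftrightarrow> side i j k = 1"
  using half_set_0[OF half] F3_simps pt_0 by (auto simp: side_def)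

lemma side_uminus: "side (-i) (-j) (-k) = - side i j k"
proof (cases "i = 0 \<and> j = 0 \<and> k = 0")
  case False
  then have "pt i j k \<noteq> 0" using pt_eq_iff[of i j k 0 0 0] pt_0 by auto
  then have "pt (-i) (-j) (-k) \<in> D \<longleftrightarrow> pt i j k \<notin> D"
    using half_set_uminus[OF half, of "pt i j k"] by (simp add: point_uminus)
  then show ?thesis using False by (simp add: side_def)
qed (simp add: side_def)

lemma side_cases: "j \<noteq> 0 \<or> k \<noteq> 0 \<Longrightarrow> side i j k = 1 \<or> side i j k = -1"
  by (auto simp: side_def)

lemma obtain_pt: obtains i j k where "v = pt i j k"
  using frame_surj[OF frame] unfolding bij_def surj_def by (metis prod.exhaust split_conv)

lemma sum_space: "(\<Sum>v\<in>UNIV. h v) = (\<Sum>i\<in>UNIV. \<Sum>j\<in>UNIV. \<Sum>k\<in>UNIV. h (pt i j k))"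
proof -
  have "(\<Sum>v\<in>UNIV. h v) = (\<Sum>(i, j, k)\<in>UNIV. h (pt i j k))"
    using sum.reindex_bij_betw[OF frame_surj[OF frame], of h] by (simp add: case_prod_unfold)
  also have "\<dots> = (\<Sum>i\<in>UNIV. \<Sum>j\<in>UNIV. \<Sum>k\<in>UNIV. h (pt i j k))"
    by (simp add: sum.cartesian_product flip: UNIV_Times_UNIV)
  finally show ?thesis .
qed

text \<open>Each pair \<open>{v, -v}\<close> contributes the same vector twice, namely its element in \<open>D\<close>; and \<open>2 = -1\<close>.\<close>

lemma signed_sum:
  "(\<Sum>i\<in>UNIV. \<Sum>j\<in>UNIV. \<Sum>k\<in>UNIV. side i j k *s pt i j k) = - s"
proof -
  define h where "h v = (if v \<in> D then v else - v)" for v :: "'a ^ 3"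
  have "side i j k *s pt i j k = h (pt i j k)" for i j k
    by (auto simp: side_def h_def pt_0)
  then have "(\<Sum>i\<in>UNIV. \<Sum>j\<in>UNIV. \<Sum>k\<in>UNIV. side i j k *s pt i j k) = (\<Sum>v\<in>UNIV. h v)"
    by (simp add: sum_space)
  also have "\<dots> = (\<Sum>v\<in>D. h v) + (\<Sum>v\<in>-D. h v)"
    by (metis Compl_eq_Diff_UNIV add.commute finite_space subset_UNIV sum.subset_diff)
  also have "(\<Sum>v\<in>D. h v) = s" using sum_D by (simp add: h_def)
  also have "(\<Sum>v\<in>-D. h v) = (\<Sum>v\<in>insert 0 D. v)"
    by (rule sum.reindex_bij_witness[where i = uminus and j = uminus])
      (use half in \<open>auto simp: h_def half_set_def, metis+\<close>)
  also have "\<dots> = s" using sum_D half_set_0[OF half] by simp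
  finally show ?thesis by (simp add: vec_triple)
qed

text \<open>These are the coordinates of \<open>signed_sum\<close> along \<open>c\<close>, \<open>b\<close> and \<open>s\<close>. Because \<open>side\<close> is odd, the
  27 terms reduce to those of the rows \<open>(1, 0)\<close>, \<open>(0, 1)\<close>, \<open>(1, 1)\<close> and \<open>(-1, 1)\<close>, which represent all
  rows other than \<open>(0, 0)\<close> up to sign.\<close>

lemma moments:
  shows "row 0 1 + row 1 1 + row (-1) 1 = 0"
    and "row 1 0 + row 1 1 - row (-1) 1 = 0"
    and "side 1 0 0 + (side 1 1 0 - side (-1) 1 0) + (side 1 0 1 - side (-1) 0 1)
         + (side 1 1 1 - side (-1) 1 1) + (side 1 (-1) 1 - side (-1) (-1) 1) = 1"
proof -
  let ?S = "\<lambda>h :: 'a \<Rightarrow> 'a \<Rightarrow> 'a \<Rightarrow> 'a. \<Sum>i\<in>UNIV. \<Sum>j\<in>UNIV. \<Sum>k\<in>UNIV. h i j k"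
  have "side i j k *s pt i j k = (side i j k * i) *s s + (side i j k * j) *s b + (side i j k * k) *s c" for i j k
    by (simp add: point_def vec.scale_right_distrib)
  then have "pt (?S (\<lambda>i j k. side i j k * i)) (?S (\<lambda>i j k. side i j k * j)) (?S (\<lambda>i j k. side i j k * k)) = - s"
    using signed_sum by (simp add: point_def sum.distrib vec.scale_sum_left)
  also have "- s = pt (-1) 0 0" by (simp add: point_def vec.scale_minus_left)
  finally have *: "?S (\<lambda>i j k. side i j k * i) = -1" "?S (\<lambda>i j k. side i j k * j) = 0" "?S (\<lambda>i j k. side i j k * k) = 0"
    by (auto simp: pt_eq_iff)
  have odd: "side 0 (-1) 0 = - side 0 1 0" "side 0 0 (-1) = - side 0 0 1" "side 0 (-1) (-1) = - side 0 1 1" "side 0 1 (-1) = - side 0 (-1) 1"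
    "side (-1) 0 0 = - side 1 0 0" "side (-1) (-1) 0 = - side 1 1 0" "side (-1) 0 (-1) = - side 1 0 1" "side (-1) (-1) (-1) = - side 1 1 1"
    "side 1 (-1) 0 = - side (-1) 1 0" "side 1 0 (-1) = - side (-1) 0 1" "side 1 (-1) (-1) = - side (-1) 1 1"
    "side (-1) 1 (-1) = - side 1 (-1) 1" "side 1 1 (-1) = - side (-1) (-1) 1" "side 0 0 0 = 0"
    using side_uminus[of 0 1 0] side_uminus[of 0 0 1] side_uminus[of 0 1 1] side_uminus[of 0 "-1" 1] side_uminus[of 1 0 0]
      side_uminus[of 1 1 0] side_uminus[of 1 0 1] side_uminus[of 1 1 1] side_uminus[of "-1" 1 0] side_uminus[of "-1" 0 1]
      side_uminus[of "-1" 1 1] side_uminus[of 1 "-1" 1] side_uminus[of "-1" "-1" 1]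
    by (simp_all add: side_def)
  have two: "x = 0" if "2 * x = 0" for x :: 'a using that F3_simps by simp
  have minus_two: "x = 1" if "2 * x = -1" for x :: 'a using that F3_simps by simp
  have "2 * (row 0 1 + row 1 1 + row (-1) 1) = 0"
    using *(3) by (simp add: sum_F3 row_def odd algebra_simps)
  then show "row 0 1 + row 1 1 + row (-1) 1 = 0" by (rule two)
  have "2 * (row 1 0 + row 1 1 - row (-1) 1) = 0"
    using *(2) by (simp add: sum_F3 row_def odd algebra_simps)
  then show "row 1 0 + row 1 1 - row (-1) 1 = 0" by (rule two)
  show "side 1 0 0 + (side 1 1 0 - side (-1) 1 0) + (side 1 0 1 - side (-1) 0 1)
         + (side 1 1 1 - side (-1) 1 1) + (side 1 (-1) 1 - side (-1) (-1) 1) = 1" (is "?L = 1")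
  proof -
    have "2 * ?L = -1"
      using *(1) by (simp add: sum_F3 odd algebra_simps)
    then show ?thesis by (rule minus_two)
  qed
qed

end

section \<open>The number of breaks\<close>

context framed_half_set
begin

lemma row_uminus: "row (-j) (-k) = - row j k"
  using side_uminus[of 0 j k] side_uminus[of 1 j k] side_uminus[of "-1" j k]
  by (simp add: row_def sum_F3)

lemma row_eq_0_iff: "j \<noteq> 0 \<or> k \<noteq> 0 \<Longrightarrow> row j k = 0 \<longleftrightarrow> (\<forall>i. side i j k = side 0 j k)"
  unfolding row_def by (rule row_constant) (rule side_cases)

lemma mem_breaks_iff:
  "pt i j k \<in> breaks D s \<longleftrightarrow> (j \<noteq> 0 \<or> k \<noteq> 0) \<and> side i j k = 1 \<and> side (i + 1) j k \<noteq> 1"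
proof -
  have 1: "pt i j k + s = pt (i + 1) j k"
    using point_add[of s b c i j k 1 0 0] by (simp add: pt_s)
  have 2: "pt i j k = s \<longleftrightarrow> i = 1 \<and> j = 0 \<and> k = 0" "pt i j k = -s \<longleftrightarrow> i = -1 \<and> j = 0 \<and> k = 0"
    using pt_eq_iff[of i j k 1 0 0] pt_eq_iff[of i j k "-1" 0 0] point_uminus[of s b c 1 0 0]
    by (auto simp: pt_s)
  have "side i 0 0 = 1 \<Longrightarrow> i = 1 \<or> i = -1"
    using F3_cases[of i] by (auto simp: side_def)
  then show ?thesis
    unfolding breaks_def mem_Collect_eq 1 2 mem_iff by auto
qed

text \<open>Every row that is not constant contains one break, and the eight rows come in four pairs
  of opposite rows.\<close>

lemma card_breaks:
  "card (breaks D s) =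
    2 * (of_bool (row 1 0 \<noteq> 0) + of_bool (row 0 1 \<noteq> 0) + of_bool (row 1 1 \<noteq> 0) + of_bool (row (-1) 1 \<noteq> 0))"
proof -
  have N: "(\<Sum>i\<in>UNIV. of_bool (pt i j k \<in> breaks D s)) = (of_bool ((j \<noteq> 0 \<or> k \<noteq> 0) \<and> row j k \<noteq> 0) :: nat)" for j k
  proof (cases "j \<noteq> 0 \<or> k \<noteq> 0")
    case True
    then show ?thesis
      using row_breaks[of "\<lambda>i. side i j k", OF side_cases[OF True]] by (simp add: mem_breaks_iff row_def)
  qed (simp add: mem_breaks_iff)
  have "card (breaks D s) = (\<Sum>v\<in>UNIV. of_bool (v \<in> breaks D s))"
    by (simp add: sum_of_bool_eq)
  also have "\<dots> = (\<Sum>i\<in>UNIV. \<Sum>j\<in>UNIV. \<Sum>k\<in>UNIV. of_bool (pt i j k \<in> breaks D s))"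
    by (rule sum_space)
  also have "\<dots> = (\<Sum>j\<in>UNIV. \<Sum>i\<in>UNIV. \<Sum>k\<in>UNIV. of_bool (pt i j k \<in> breaks D s))"
    by (rule sum.swap)
  also have "\<dots> = (\<Sum>j\<in>UNIV. \<Sum>k\<in>UNIV. \<Sum>i\<in>UNIV. of_bool (pt i j k \<in> breaks D s))"
    by (intro sum.cong refl sum.swap)
  also have "\<dots> = (\<Sum>j\<in>UNIV. \<Sum>k\<in>UNIV. of_bool ((j \<noteq> 0 \<or> k \<noteq> 0) \<and> row j k \<noteq> 0))"
    by (simp only: N)
  finally show ?thesis
    using row_uminus[of 1 0] row_uminus[of 0 1] row_uminus[of 1 1] row_uminus[of "-1" 1]
    by (simp add: sum_F3)
qed

lemma card_breaks_cases: "card (breaks D s) = 0 \<or> card (breaks D s) = 6"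
proof -
  have "n \<in> {0, 3} \<Longrightarrow> 2 * n = 0 \<or> 2 * n = 6" for n :: nat by auto
  from this[OF tetracode_weight[OF moments(1,2)]] show ?thesis unfolding card_breaks .
qed

lemma zero_row_exists:
  obtains j k where "j \<noteq> 0 \<or> k \<noteq> 0" "row j k = 0"
  using tetracode_weight[OF moments(1,2)] that[of 1 0] that[of 0 1] that[of 1 1] that[of "-1" 1]
  by (cases "row 1 0 = 0"; cases "row 0 1 = 0"; cases "row 1 1 = 0"; cases "row (-1) 1 = 0") auto

lemma rows_0_if_breaks_empty:
  assumes "breaks D s = {}"
  shows "row 1 0 = 0" "row 0 1 = 0" "row 1 1 = 0" "row (-1) 1 = 0"
  using card_breaks assms by (auto split: if_splits)

text \<open>If all rows are constant, their first moments vanish, and the third moment equation reduces to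
  \<open>side 1 0 0 = 1\<close>. This excludes \<open>-s \<in> D\<close>.\<close>

lemma mem_if_breaks_empty:
  assumes "breaks D s = {}"
  shows "s \<in> D"
proof -
  have c: "\<And>i. side i 1 0 = side 0 1 0" "\<And>i. side i 0 1 = side 0 0 1" "\<And>i. side i 1 1 = side 0 1 1" "\<And>i. side i (-1) 1 = side 0 (-1) 1"
    using rows_0_if_breaks_empty[OF assms] row_eq_0_iff[of 1 0] row_eq_0_iff[of 0 1] row_eq_0_iff[of 1 1] row_eq_0_iff[of "-1" 1]
    by auto
  have "side 1 0 0 = 1"
    using moments(3) c(1)[of 1] c(1)[of "-1"] c(2)[of 1] c(2)[of "-1"] c(3)[of 1] c(3)[of "-1"] c(4)[of 1] c(4)[of "-1"]
    by simp
  then show ?thesis using mem_iff[of 1 0 0] by (simp add: pt_s)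
qed

end

section \<open>Flips that lead to level 3\<close>

context ternary_field
begin

text \<open>The flipped set contains its sum \<open>s + d\<close>. It also contains \<open>s\<close>, and closure under translation by
  \<open>s + d\<close> takes \<open>s\<close> to \<open>2 s + d = d - s\<close>.\<close>

lemma neighbour_level_3_needs_coset:
  fixes D :: "('a ^ 3) set"
  assumes D: "half_set D" "d \<in> D" and s: "\<Sum>D \<in> D" "d \<noteq> \<Sum>D" and l: "level (flip d D) = 3"
  shows "d + \<Sum>D \<in> D" and "d - \<Sum>D \<in> D"
proof -
  let ?s = "\<Sum>D"
  have nz: "d \<noteq> 0" "?s \<noteq> 0" using D s half_set_0 by fastforce+
  have nm: "?s \<noteq> -d" using D s half_set_uminus[OF D(1) nz(1)] by metis
  have t: "?s + d \<in> flip d D" and inv: "\<And>v. v \<in> flip d D \<Longrightarrow> v \<noteq> ?s + d \<Longrightarrow> v + (?s + d) \<in> flip d D"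
    using l level_flip_eq_3_iff[OF D] by auto
  have dd: "?s + d \<noteq> - d" 
  proof
    assume "?s + d = - d"
    then have "?s + d = d + d" by (simp add: vec_triple)
    then show False using s by simp
  qed
  then show "d + ?s \<in> D" using t by (simp add: mem_flip add.commute)
  have "?s + (?s + d) \<in> flip d D"
    using inv[of ?s] s nz nm by (simp add: mem_flip)
  also have "?s + (?s + d) = d - ?s"
    using vec_triple[of ?s] by (simp flip: add.assoc)
  finally have "d - ?s \<in> flip d D" .
  moreover have "d - ?s \<noteq> -d"
  proof
    assume "d - ?s = - d"
    then have "?s = d + d" by (simp add: algebra_simps eq_neg_iff_add_eq_0)
    then show False using nm by (simp add: vec_triple)
  qed
  ultimately show "d - ?s \<in> D" by (simp add: mem_flip)
qed

text \<open>The flip at \<open>s\<close> changes the sum to \<open>2 s = -s\<close>. Translation by \<open>s\<close> has order three, so closure under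
  it is the same as closure under its inverse.\<close>

lemma level_flip_sum_eq_3_iff:
  fixes D :: "('a ^ 3) set"
  assumes D: "half_set D" and s: "\<Sum>D \<in> D"
  shows "level (flip (\<Sum>D) D) = 3 \<longleftrightarrow> breaks D (\<Sum>D) = {}"
proof -
  let ?s = "\<Sum>D"
  have nz: "?s \<noteq> 0" using D s half_set_0 by fastforce
  have ms: "-?s \<notin> D" using half_set_uminus[OF D nz] s by simp
  let ?E = "flip ?s D"
  have E: "v \<in> ?E \<and> v \<noteq> - ?s \<longleftrightarrow> v \<in> D \<and> v \<noteq> ?s" for v
    using ms by (auto simp: mem_flip)
  have E_minus: "v - ?s \<in> ?E \<longleftrightarrow> v - ?s \<in> D" if "v \<in> D" for v
  proof -
    have "v \<noteq> 0" using that D half_set_0 by fastforce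
    moreover have "v \<noteq> ?s + ?s" using that ms by (auto simp: vec_triple)
    ultimately show ?thesis by (auto simp: mem_flip diff_eq_eq)
  qed
  have "- ?s \<in> ?E" by (simp add: mem_flip)
  then have "level ?E = 3 \<longleftrightarrow> (\<forall>v. v \<in> ?E \<and> v \<noteq> - ?s \<longrightarrow> v - ?s \<in> ?E)"
    unfolding level_flip_eq_3_iff[OF D s] vec_triple add_uminus_conv_diff by blast
  also have "\<dots> \<longleftrightarrow> (\<forall>v\<in>D. v \<noteq> ?s \<longrightarrow> v - ?s \<in> D)"
    unfolding E using E_minus by blast
  also have "\<dots> \<longleftrightarrow> (\<forall>v\<in>D. v \<noteq> ?s \<longrightarrow> v + ?s \<in> D)"
  proof -
    have m: "(v + ?s) + ?s = v - ?s" "(v - ?s) - ?s = v + ?s" for v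
      by (simp_all only: add.assoc diff_diff_eq vec_triple add_uminus_conv_diff diff_minus_eq_add)
    have ne: "v + ?s \<noteq> ?s \<and> v - ?s \<noteq> ?s" if "v \<in> D" for v
      using that ms half_set_0[OF D] by (auto simp: diff_eq_eq vec_triple)
    show ?thesis
    proof (intro iffI ballI impI)
      fix v assume "\<forall>v\<in>D. v \<noteq> ?s \<longrightarrow> v - ?s \<in> D" "v \<in> D" "v \<noteq> ?s"
      then have "(v - ?s) - ?s \<in> D" using ne by blast
      then show "v + ?s \<in> D" unfolding m .
    next
      fix v assume "\<forall>v\<in>D. v \<noteq> ?s \<longrightarrow> v + ?s \<in> D" "v \<in> D" "v \<noteq> ?s"
      then have "(v + ?s) + ?s \<in> D" using ne by blast
      then show "v - ?s \<in> D" unfolding m .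
    qed
  qed
  also have "\<dots> \<longleftrightarrow> breaks D ?s = {}" using ms by (auto simp: breaks_def)
  finally show ?thesis .
qed

end

context framed_half_set
begin

lemma row_full:
  assumes "j \<noteq> 0 \<or> k \<noteq> 0" "pt i j k \<in> D" "pt i j k + s \<in> D" "pt i j k - s \<in> D"
  shows "row j k = 0"
proof -
  have "pt i j k + s = pt (i + 1) j k"
    using point_add[of s b c i j k 1 0 0] by (simp add: pt_s)
  moreover have "pt i j k - s = pt (i - 1) j k"
    using point_add[of s b c "i - 1" j k 1 0 0] by (simp add: pt_s diff_eq_eq)
  ultimately have *: "side i j k = 1" "side (i + 1) j k = 1" "side (i - 1) j k = 1"
    using assms by (simp_all add: mem_iff)
  have "side x j k = 1" for x
    using * F3_cases[of "x - i"] by (auto simp: diff_eq_eq add.commute)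
  then show ?thesis using row_eq_0_iff[OF assms(1)] by simp
qed

text \<open>By the tetracode, some row other than \<open>(0, 0)\<close> is constant; it or its negative lies in \<open>D\<close>.\<close>

lemma coset_in_half_set_exists:
  obtains b' where "b' \<noteq> 0" "b' \<noteq> s" "b' \<noteq> -s" "\<And>i. i *s s + b' \<in> D"
proof -
  obtain j k where jk: "j \<noteq> 0 \<or> k \<noteq> 0" and "row j k = 0" using zero_row_exists .
  then have const: "side i j k = side 0 j k" for i using row_eq_0_iff[OF jk] by auto
  define x where "x = side 0 j k"
  have x: "x = 1 \<or> x = -1" unfolding x_def by (rule side_cases[OF jk])
  have "side i (x * j) (x * k) = 1" for i
    using x const[of i] const[of "-i"] side_uminus[of "-i" j k] by (auto simp: x_def)
  then have "pt i (x * j) (x * k) \<in> D" for i by (simp add: mem_iff)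
  moreover have "pt i (x * j) (x * k) = i *s s + pt 0 (x * j) (x * k)" for i
    by (simp add: point_def add.assoc)
  ultimately have in_D: "i *s s + pt 0 (x * j) (x * k) \<in> D" for i by metis
  have "pt 0 (x * j) (x * k) \<noteq> pt y 0 0" for y
    using jk x by (auto simp: pt_eq_iff)
  from this[of 0] this[of 1] this[of "-1"] show thesis
    using point_uminus[of s b c 1 0 0] by (intro that[OF _ _ _ in_D]) (simp_all add: pt_s pt_0)
qed

lemma level_3_row_constant:
  assumes "breaks D s = {}" "j \<noteq> 0 \<or> k \<noteq> 0"
  shows "side i j k = side 0 j k"
proof -
  have "row j k = 0"
    using rows_0_if_breaks_empty[OF assms(1)] assms(2) F3_cases[of j] F3_cases[of k]
      row_uminus[of 1 0] row_uminus[of 0 1] row_uminus[of 1 1] row_uminus[of "-1" 1]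
    by auto
  then show ?thesis using row_eq_0_iff[OF assms(2)] by blast
qed

text \<open>Replacing \<open>b'\<close> and \<open>c'\<close> by their negatives moves the coset of \<open>b'\<close> and the affine plane of \<open>c'\<close>
  into \<open>D\<close>.\<close>

lemma orient_frame:
  assumes "frame s b' c'"
    and "\<And>i. point s b' c' i 1 0 \<in> D \<longleftrightarrow> \<beta>"
    and "\<And>i j. point s b' c' i j 1 \<in> D \<longleftrightarrow> \<gamma>"
  shows "\<exists>b c. frame s b c \<and> (\<forall>i. point s b c i 1 0 \<in> D) \<and> (\<forall>i j. point s b c i j 1 \<in> D)"
proof -
  define x y :: 'a where "x = (if \<beta> then 1 else -1)" and "y = (if \<gamma> then 1 else -1)"
  have fr: "frame s (x *s b') (y *s c')"
    using frame_scale[OF assms(1), of x y] by (simp add: x_def y_def)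
  have scale: "point s (x *s b') (y *s c') i j k = point s b' c' i (j * x) (k * y)" for i j k
    by (simp add: point_def)
  have neg: "point s b' c' (-i) (-j) (-k) \<in> D \<longleftrightarrow> point s b' c' i j k \<notin> D" if "j \<noteq> 0 \<or> k \<noteq> 0" for i j k
  proof -
    have "point s b' c' i j k \<noteq> 0" using assms(1) that unfolding frame_def by blast
    then show ?thesis using half_set_uminus[OF half, of "point s b' c' i j k"] by (simp add: point_uminus)
  qed
  have "point s (x *s b') (y *s c') i 1 0 \<in> D" for i
    using assms(2) neg[of 1 0 "-i"] unfolding scale by (simp add: x_def)
  moreover have "point s (x *s b') (y *s c') i j 1 \<in> D" for i j
    using assms(3) neg[of "-(j * x)" 1 "-i"] unfolding scale by (simp add: y_def)
  ultimately show ?thesis using fr by blast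
qed

text \<open>At level 3, \<open>D - {s}\<close> is the preimage of a half set of the quotient of \<open>V\<close> by the line of \<open>s\<close>, a plane
  over the field with three elements. The 16 half sets of such a plane are all of the form
  \<open>{b} \<union> (c + {0, b, -b})\<close>: the signs of four representatives always satisfy one of the four
  cases below, which say that the half set is of this form with \<open>b\<close> on the first axis, on the second axis,
  or on one of the two diagonals.\<close>

lemma level_3_normal_form:
  assumes "breaks D s = {}"
  shows "\<exists>b c. frame s b c \<and> (\<forall>i. point s b c i 1 0 \<in> D) \<and> (\<forall>i j. point s b c i j 1 \<in> D)"
proof -
  define h where "h j k \<longleftrightarrow> side 0 j k = 1" for j k
  have mem: "pt i j k \<in> D \<longleftrightarrow> h j k" if "j \<noteq> 0 \<or> k \<noteq> 0" for i j k
    using level_3_row_constant[OF assms that, of i] by (simp add: h_def mem_iff)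
  have neg: "h (-j) (-k) \<longleftrightarrow> \<not> h j k" if "j \<noteq> 0 \<or> k \<noteq> 0" for j k
    using side_uminus[of 0 j k] side_cases[OF that, of 0] F3_simps by (auto simp: h_def)
  have n: "h 1 (-1) \<longleftrightarrow> \<not> h (-1) 1" "h (-1) 0 \<longleftrightarrow> \<not> h 1 0" "h (-1) (-1) \<longleftrightarrow> \<not> h 1 1"
    using neg[of "-1" 1] neg[of 1 0] neg[of 1 1] by auto
  consider
      "h 1 1 = h 0 1" "h (-1) 1 = h 0 1"
    | "h 1 1 = h 1 0" "h 1 (-1) = h 1 0"
    | "h 1 (-1) = h 0 1" "h (-1) 0 = h 0 1"
    | "h 1 0 = h 0 1" "h (-1) (-1) = h 0 1"
    using n by blast
  then show ?thesis
  proof cases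
    case 1
    have "h j 1 = h 0 1" for j using 1 F3_cases[of j] by auto
    then show ?thesis
      by (intro orient_frame[OF frame, of "h 1 0" "h 0 1"]) (simp_all add: mem)
  next
    case 2
    have sw: "point s c b i j k = pt i k j" for i j k by (simp add: point_def add_ac)
    have "h 1 j = h 1 0" for j using 2 F3_cases[of j] by auto
    then show ?thesis
      by (intro orient_frame[OF frame_swap[OF frame], of "h 0 1" "h 1 0"]) (simp_all add: mem sw)
  next
    case 3
    have sh: "point s (b + 1 *s c) c i j k = pt i j (j + k)" for i j k
      by (simp add: point_def vec.scale_right_distrib vec.scale_left_distrib add_ac)
    have "h j (j + 1) = h 0 1" for j using 3 F3_cases[of j] by (auto simp: F3_simps)
    moreover have "j \<noteq> 0 \<or> j + 1 \<noteq> 0" for j :: 'a by auto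
    ultimately show ?thesis
      by (intro orient_frame[OF frame_shear[OF frame, of 1], of "h 1 1" "h 0 1"]) (simp_all only: sh mem, simp_all add: mem)
  next
    case 4
    have sh: "point s (b + (-1) *s c) c i j k = pt i j (k - j)" for i j k
      by (simp add: point_def vec.scale_right_diff_distrib vec.scale_left_diff_distrib vec.scale_minus_left)
    have "h j (1 - j) = h 0 1" for j using 4 F3_cases[of j] by (auto simp: F3_simps)
    moreover have "j \<noteq> 0 \<or> 1 - j \<noteq> 0" for j :: 'a by auto
    ultimately show ?thesis
      by (intro orient_frame[OF frame_shear[OF frame, of "-1"], of "h 1 (-1)" "h 0 1"]) (simp_all only: sh mem, simp_all add: mem)
  qed
qed

end

text \<open>The elements of \<open>D\<close> in the plane spanned by \<open>s\<close> and \<open>b\<close> are \<open>s\<close> and the coset \<open>b + {0, s, -s}\<close>.\<close>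

locale coset_framed_half_set = framed_half_set ty D s b c
  for ty :: "'a::field itself" and D s b c +
  assumes s_mem: "s \<in> D" and coset: "pt i 1 0 \<in> D"
begin

lemma side_plane: "side 0 0 0 = 0" "side 1 0 0 = 1" "side (-1) 0 0 = -1" "side i 1 0 = 1" "side i (-1) 0 = -1"
  using mem_iff[of 1 0 0] s_mem coset[of i] coset[of "-i"] mem_iff[of i 1 0] mem_iff[of "-i" 1 0]
    side_uminus[of 1 0 0] side_uminus[of "-i" 1 0]
  by (simp_all add: pt_s side_def[of 0 0 0])

text \<open>Inside the plane of \<open>s\<close> and \<open>b\<close>, the flipped set always consists of its sum \<open>t = s + d\<close> and a coset of
  \<open>{0, t, -t}\<close>. Outside this plane nothing is flipped, and by oddness it is enough to look at the
  affine plane \<open>k = 1\<close>.\<close>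

lemma level_flip_coset_eq_3_iff:
  "level (flip (pt i 1 0) D) = 3 \<longleftrightarrow> (\<forall>x y. side (x + (i + 1)) (y + 1) 1 = side x y 1)"
proof -
  let ?E = "flip (pt i 1 0) D"
  have sum: "\<Sum>D + pt i 1 0 = pt (i + 1) 1 0"
    using point_add[of s b c 1 0 0 i 1 0] sum_D by (simp add: pt_s add.commute)
  have mem_E: "pt x y z \<in> ?E \<longleftrightarrow> (x = -i \<and> y = -1 \<and> z = 0) \<or> (side x y z = 1 \<and> \<not> (x = i \<and> y = 1 \<and> z = 0))" for x y z
    by (simp add: mem_flip point_uminus pt_eq_iff mem_iff)
  have head: "pt (i + 1) 1 0 \<in> ?E" by (simp add: mem_E side_plane)
  have "level ?E = 3 \<longleftrightarrow>
    (\<forall>x y z. pt x y z \<in> ?E \<longrightarrow> pt x y z \<noteq> pt (i + 1) 1 0 \<longrightarrow> pt x y z + pt (i + 1) 1 0 \<in> ?E)"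
    unfolding level_flip_eq_3_iff[OF half coset] sum using head by (metis obtain_pt)
  also have "\<dots> \<longleftrightarrow> (\<forall>x y z. pt x y z \<in> ?E \<longrightarrow> \<not> (x = i + 1 \<and> y = 1 \<and> z = 0) \<longrightarrow> pt (x + (i + 1)) (y + 1) z \<in> ?E)"
    by (simp add: point_add pt_eq_iff)
  also have "\<dots> \<longleftrightarrow> (\<forall>x y. side (x + (i + 1)) (y + 1) 1 = side x y 1)" (is "?L \<longleftrightarrow> ?R")
  proof
    assume L: ?L
    have step: "side (x + (i + 1)) (y + 1) 1 = 1" if "side x y 1 = 1" for x y
      using L[rule_format, of x y 1] that by (simp add: mem_E)
    show ?R
    proof (intro allI)
      fix x y
      have "side x y 1 = 1" if "side (x + (i + 1)) (y + 1) 1 = 1"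
      proof -
        \<comment> \<open>Two further translations complete a full turn.\<close>
        have "side (x + (i + 1) + (i + 1) + (i + 1)) (y + 1 + 1 + 1) 1 = 1"
          using that step by blast
        moreover have "x + (i + 1) + (i + 1) + (i + 1) = x" "y + 1 + 1 + 1 = y"
          using F3_triple[of "i + 1"] F3_triple[of 1] by (simp_all only: add.assoc add_0_right)
        ultimately show ?thesis by simp
      qed
      then show "side (x + (i + 1)) (y + 1) 1 = side x y 1"
        using step[of x y] side_cases[of y 1 x] side_cases[of "y + 1" 1 "x + (i + 1)"] by auto
    qed
  next
    assume R: ?R
    show ?L
    proof (intro allI impI)
      fix x y z assume E: "pt x y z \<in> ?E" and ne: "\<not> (x = i + 1 \<and> y = 1 \<and> z = 0)"
      consider "z = 0" | "z = 1" | "z = -1" using F3_cases by blast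
      then show "pt (x + (i + 1)) (y + 1) z \<in> ?E"
      proof cases
        case 1
        consider "y = 0" | "y = 1" | "y = -1" using F3_cases by blast
        then show ?thesis
        proof cases
          assume y: "y = 0"
          then have "x = 1" using E 1 F3_cases[of x] by (auto simp: mem_E side_plane F3_simps)
          moreover have "1 + (i + 1) \<noteq> i" using F3_simps(3) by (simp add: eq_neg_iff_add_eq_0)
          ultimately show ?thesis using 1 y by (simp add: mem_E side_plane)
        next
          assume y: "y = 1"
          then have "x - i \<noteq> 0" "x - i \<noteq> 1" using E ne 1 by (auto simp: mem_E F3_simps diff_eq_eq add.commute)
          then have "x = i - 1" using F3_cases[of "x - i"] by (auto simp: diff_eq_eq)
          then have "x + (i + 1) = -i" using F3_triple[of i] by (simp add: eq_neg_iff_add_eq_0)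
          then show ?thesis using 1 y by (simp add: mem_E F3_simps)
        next
          assume y: "y = -1"
          then have "x = -i" using E 1 by (auto simp: mem_E side_plane F3_simps)
          then show ?thesis using 1 y by (simp add: mem_E side_plane)
        qed
      next
        case 2
        then show ?thesis using E R by (simp add: mem_E)
      next
        case 3
        have "side (x + (i + 1)) (y + 1) (-1) = - side (- (x + (i + 1))) (- (y + 1)) 1"
          using side_uminus[of "- (x + (i + 1))" "- (y + 1)" 1] by (simp only: minus_minus)
        also have "\<dots> = - side (-x) (-y) 1"
          using R[rule_format, of "- (x + (i + 1))" "- (y + 1)"] by (simp add: algebra_simps)
        also have "\<dots> = side x y (-1)" using side_uminus[of "-x" "-y" 1] by simp
        finally show ?thesis using E 3 by (simp add: mem_E)
      qed
    qed
  qed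
  finally show ?thesis .
qed

text \<open>In the affine plane \<open>k = 1\<close>, no row is constant and all three rows have the same majority sign \<open>g\<close>.
  The moment equation along \<open>s\<close> says that the positions of the minority signs sum to zero, which makes
  them collinear. So the only direction of the form \<open>e s + b\<close> that preserves the signs is the direction
  of their line, \<open>e = m1 - m0\<close>.\<close>

lemma card_level_3_neighbours_if_broken:
  assumes br: "breaks D s \<noteq> {}"
  shows "card {d \<in> D. level (flip d D) = 3} = 1"
proof -
  define g where "g = row 0 1"
  have "\<forall>i. side i 1 0 = side 0 1 0" by (simp add: side_plane)
  then have r10: "row 1 0 = 0" using row_eq_0_iff[of 1 0] by simp
  then have rows: "row 0 1 = g" "row 1 1 = g" "row (-1) 1 = g"
    using moments(1,2) F3_cases[of "row (-1) 1"] by (auto simp: g_def F3_simps add_eq_0_iff)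
  have "card (breaks D s) \<noteq> 0" using br by simp
  then have g: "g \<noteq> 0" unfolding card_breaks rows r10 by (cases "g = 0") simp_all
  have rows_ne: "row j k \<noteq> 0" if "k \<noteq> 0" for j k
    using that F3_cases[of j] F3_cases[of k] rows g row_uminus[of 0 1] row_uminus[of 1 1] row_uminus[of "-1" 1]
    by auto
  obtain m0 where m0: "\<And>i. side i 0 1 = (if i = m0 then -g else g)" "side 1 0 1 - side (-1) 0 1 = g * m0"
    using row_minority[of "\<lambda>i. side i 0 1" g] side_cases[of 0 1] rows g by (auto simp: row_def)
  obtain m1 where m1: "\<And>i. side i 1 1 = (if i = m1 then -g else g)" "side 1 1 1 - side (-1) 1 1 = g * m1"
    using row_minority[of "\<lambda>i. side i 1 1" g] side_cases[of 1 1] rows g by (auto simp: row_def)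
  obtain m2 where m2: "\<And>i. side i (-1) 1 = (if i = m2 then -g else g)" "side 1 (-1) 1 - side (-1) (-1) 1 = g * m2"
    using row_minority[of "\<lambda>i. side i (-1) 1" g] side_cases[of "-1" 1] rows g by (auto simp: row_def)
  have "g * (m0 + m1 + m2) = 0"
    using moments(3) m0(2) m1(2) m2(2) by (simp add: side_plane algebra_simps)
  then have "m0 + m1 + m2 = 0" using g by (metis mult_eq_0_iff)
  then have m_sum: "m2 = - m0 - m1" by (simp add: algebra_simps eq_neg_iff_add_eq_0)
  have g_ne: "g \<noteq> -g" "-g \<noteq> g" using g F3_cases[of g] F3_simps by auto
  have shift: "(\<forall>x y. side (x + e) (y + 1) 1 = side x y 1) \<longleftrightarrow> e = m1 - m0" for e
  proof
    assume "\<forall>x y. side (x + e) (y + 1) 1 = side x y 1"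
    then have "side (m0 + e) 1 1 = side m0 0 1" by (metis add_0)
    then have "m0 + e = m1" using m0(1)[of m0] m1(1)[of "m0 + e"] g_ne by (auto split: if_splits)
    then show "e = m1 - m0" by auto
  next
    assume e: "e = m1 - m0"
    show "\<forall>x y. side (x + e) (y + 1) 1 = side x y 1"
    proof (intro allI)
      fix x y
      \<comment> \<open>Modulo 3, \<open>m0 + m1 + m2 = 0\<close> says that \<open>m0, m1, m2\<close> is an arithmetic progression.\<close>
      have "m1 = m0 + e" by (simp add: e)
      moreover have "m2 = m1 + e" using F3_triple[of m1] unfolding e m_sum by algebra
      moreover have "m0 = m2 + e" using F3_triple[of m0] unfolding e m_sum by algebra
      ultimately show "side (x + e) (y + 1) 1 = side x y 1"
        using F3_cases[of y] by (auto simp: m0(1) m1(1) m2(1) F3_simps)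
    qed
  qed
  have "d = pt (m1 - m0 - 1) 1 0" if d: "d \<in> D" "level (flip d D) = 3" for d
  proof -
    obtain i j k where ijk: "d = pt i j k" by (rule obtain_pt)
    have "d \<noteq> s"
      using d(2) br level_flip_sum_eq_3_iff[OF half] s_mem sum_D by auto
    then have nb: "d + s \<in> D" "d - s \<in> D"
      using neighbour_level_3_needs_coset[OF half d(1) _ _ d(2)] s_mem sum_D by auto
    have jk: "j \<noteq> 0 \<or> k \<noteq> 0"
    proof (rule ccontr)
      assume "\<not> ?thesis"
      then have "d = s" using d(1) F3_cases[of i] ijk by (auto simp: mem_iff side_plane pt_s F3_simps)
      then show False using \<open>d \<noteq> s\<close> by simp
    qed
    have "row j k = 0" using row_full[OF jk] d(1) nb ijk by blast
    then have "k = 0" using rows_ne by blast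
    then have "j = 1" using jk d(1) ijk F3_cases[of j] by (auto simp: mem_iff side_plane F3_simps)
    with \<open>k = 0\<close> have "d = pt i 1 0" using ijk by simp
    moreover from this have "i + 1 = m1 - m0"
      using d(2) level_flip_coset_eq_3_iff[of i] shift[of "i + 1"] by simp
    then have "i = m1 - m0 - 1" by (metis add_diff_cancel_right')
    ultimately show ?thesis by simp
  qed
  moreover have "level (flip (pt (m1 - m0 - 1) 1 0) D) = 3"
    using level_flip_coset_eq_3_iff[of "m1 - m0 - 1"] shift[of "m1 - m0"] by simp
  ultimately have "{d \<in> D. level (flip d D) = 3} = {pt (m1 - m0 - 1) 1 0}"
    using coset by auto
  then show ?thesis by simp
qed

text \<open>Here \<open>D\<close> is in normal form. The flip at \<open>s\<close> keeps the level, and so do the flips at the coset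
  of \<open>b\<close>, because the signs in the affine plane \<open>k = 1\<close> are constant.\<close>

lemma card_level_3_neighbours_if_unbroken:
  assumes br: "breaks D s = {}" and slice: "\<And>i j. pt i j 1 \<in> D"
  shows "card {d \<in> D. level (flip d D) = 3} = 4"
proof -
  have side_slice: "side i j 1 = 1" "side i j (-1) = -1" for i j
    using slice[of i j] slice[of "-i" "-j"] side_uminus[of "-i" "-j" 1] by (simp_all add: mem_iff)
  \<comment> \<open>After a flip in the affine plane, two translations by the new sum would take \<open>b\<close> to the
    opposite affine plane, where the only element of the set is another point, the negative of the flipped one.\<close>
  have not_3: "level (flip (pt i j 1) D) \<noteq> 3" for i j
  proof
    let ?E = "flip (pt i j 1) D" and ?t = "pt (i + 1) j 1"
    assume "level ?E = 3"
    moreover have "\<Sum>D + pt i j 1 = ?t"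
      using point_add[of s b c 1 0 0 i j 1] sum_D by (simp add: pt_s add.commute)
    ultimately have inv: "v + ?t \<in> ?E" if "v \<in> ?E" "v \<noteq> ?t" for v
      using that level_flip_eq_3_iff[OF half slice, of i j] by simp
    have "pt 0 1 0 \<in> ?E" by (simp add: mem_flip pt_eq_iff coset)
    then have "pt (i + 1) (j + 1) 1 \<in> ?E"
      using inv[of "pt 0 1 0"] by (simp add: point_add pt_eq_iff add.commute)
    then have "pt (i + 1 + (i + 1)) (j + 1 + j) (-1) \<in> ?E"
      using inv[of "pt (i + 1) (j + 1) 1"] by (simp add: point_add pt_eq_iff F3_simps)
    then have "j + 1 + j = - j"
      by (auto simp: mem_flip mem_iff side_slice F3_simps point_uminus pt_eq_iff)
    then have "j + j + j + 1 = 0" by (simp add: algebra_simps eq_neg_iff_add_eq_0)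
    then show False by (simp add: F3_simps)
  qed
  have coset_3: "level (flip (pt i 1 0) D) = 3" for i
    by (simp add: level_flip_coset_eq_3_iff side_slice)
  have s_3: "level (flip s D) = 3"
    using level_flip_sum_eq_3_iff[OF half] s_mem sum_D br by simp
  have "d \<in> insert s (range (\<lambda>i. pt i 1 0))" if "d \<in> D" "level (flip d D) = 3" for d
  proof -
    obtain i j k where d: "d = pt i j k" by (rule obtain_pt)
    have "k \<noteq> 1" using that(2) not_3[of i j] d by auto
    then have "(i = 1 \<and> j = 0 \<and> k = 0) \<or> (j = 1 \<and> k = 0)"
      using that(1) d F3_cases[of i] F3_cases[of j] F3_cases[of k]
      by (auto simp: mem_iff side_plane side_slice F3_simps)
    then show ?thesis using d pt_s by auto
  qed
  then have "{d \<in> D. level (flip d D) = 3} = insert s (range (\<lambda>i. pt i 1 0))"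
    using s_mem coset s_3 coset_3 by auto
  moreover have "s \<notin> range (\<lambda>i. pt i 1 0)" using pt_eq_iff[of 1 0 0] pt_s by auto
  moreover have "card (range (\<lambda>i. pt i 1 0)) = 3"
    using card3 by (subst card_image) (auto intro: injI simp: pt_eq_iff)
  ultimately show ?thesis by simp
qed

end

section \<open>The quotient matrix\<close>

text \<open>The entry \<open>(i, j)\<close> is the number of neighbours of level \<open>j\<close> of a half set of level \<open>i\<close>.\<close>

definition quotient :: "nat \<Rightarrow> nat \<Rightarrow> nat" where
  "quotient i j = [[0, 13, 0, 0], [1, 6, 6, 0], [0, 6, 6, 1], [0, 0, 9, 4]] ! i ! j"

context ternary_field
begin

lemma obtain_frame:
  fixes s :: "'a ^ 3"
  assumes "s \<noteq> 0"
  obtains b c where "frame s b c"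
proof -
  have "card {0, s, -s} < card (UNIV :: ('a ^ 3) set)"
    unfolding card_space using card_length[of "[0, s, -s]"] by simp
  then have "{0, s, -s} \<noteq> UNIV" by (metis less_irrefl)
  then obtain b where "b \<notin> {0, s, -s}" by blast
  then show thesis using frame_exists[OF assms, of b] that by blast
qed

lemma card_level_1_neighbours:
  fixes D :: "('a ^ 3) set"
  assumes "half_set D" "\<Sum>D \<noteq> 0"
  shows "card {d \<in> D. level (flip d D) = 1} = (if breaks D (\<Sum>D) = {} then 0 else 6)"
proof -
  have "{d \<in> D. level (flip d D) = 1} = breaks D (\<Sum>D)"
    using level_flip_eq_1_iff[OF assms(1) _ assms(2)] by (auto simp: breaks_def)
  moreover obtain b c where "frame (\<Sum>D) b c" using obtain_frame[OF assms(2)] .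
  then interpret framed_half_set ty D "\<Sum>D" b c by unfold_locales (use assms in auto)
  have "card (breaks D (\<Sum>D)) = (if breaks D (\<Sum>D) = {} then 0 else 6)"
    using card_breaks_cases by (auto simp: card_eq_0_iff)
  ultimately show ?thesis by simp
qed

lemma card_level_3_neighbours:
  fixes D :: "('a ^ 3) set"
  assumes D: "half_set D" and s: "\<Sum>D \<in> D"
  shows "card {d \<in> D. level (flip d D) = 3} = (if breaks D (\<Sum>D) = {} then 4 else 1)"
proof -
  have s0: "\<Sum>D \<noteq> 0" using s half_set_0[OF D] by metis
  obtain b c where "frame (\<Sum>D) b c" using obtain_frame[OF s0] .
  then interpret F: framed_half_set ty D "\<Sum>D" b c by unfold_locales (use D in auto)
  show ?thesis
  proof (cases "breaks D (\<Sum>D) = {}")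
    case True
    then obtain b' c' where fr: "frame (\<Sum>D) b' c'"
      and D': "\<And>i. point (\<Sum>D) b' c' i 1 0 \<in> D" "\<And>i j. point (\<Sum>D) b' c' i j 1 \<in> D"
      using F.level_3_normal_form by auto
    interpret C: coset_framed_half_set ty D "\<Sum>D" b' c'
      by unfold_locales (use D fr s D' in auto)
    show ?thesis using C.card_level_3_neighbours_if_unbroken[OF True D'(2)] True by simp
  next
    case False
    obtain b' where b': "b' \<noteq> 0" "b' \<noteq> \<Sum>D" "b' \<noteq> - \<Sum>D" "\<And>i. i *s \<Sum>D + b' \<in> D"
      using F.coset_in_half_set_exists by blast
    obtain c' where fr: "frame (\<Sum>D) b' c'" using frame_exists[OF s0 b'(1-3)] .
    interpret C: coset_framed_half_set ty D "\<Sum>D" b' c'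
      by unfold_locales (use D fr s b'(4) in \<open>auto simp: point_def\<close>)
    show ?thesis using C.card_level_3_neighbours_if_broken[OF False] False by simp
  qed
qed

text \<open>If \<open>s = 0\<close>, all flips lead to level 1. Otherwise the numbers of flips that lead to the levels 0, 1 and 3
  are known, and level 2 takes the rest of the 13.\<close>

theorem card_level_neighbours:
  fixes D :: "('a ^ 3) set"
  assumes D: "half_set D" and j: "j \<le> 3"
  shows "card {d \<in> D. level (flip d D) = j} = quotient (level D) j"
proof -
  define n where "n j = card {d \<in> D. level (flip d D) = j}" for j
  have "(\<Sum>j\<le>3. \<Sum>d | d \<in> D \<and> level (flip d D) = j. 1) = (\<Sum>d\<in>D. 1 :: nat)"
    by (rule sum.group) (use level_le in auto)
  then have total: "n 0 + n 1 + n 2 + n 3 = 13"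
    by (simp add: n_def card_half_set[OF D] eval_nat_numeral)
  have j': "j = 0 \<or> j = 1 \<or> j = 2 \<or> j = 3" using j by auto
  have n0: "n 0 = (if - \<Sum>D \<in> D then 1 else 0)"
  proof -
    have "{d \<in> D. level (flip d D) = 0} = (if - \<Sum>D \<in> D then {- \<Sum>D} else {})"
      using level_flip_eq_0_iff[OF D] by auto
    then show ?thesis by (simp add: n_def)
  qed
  have "n j = quotient (level D) j"
  proof (cases "\<Sum>D = 0")
    case True
    have "level (flip d D) = 1" if "d \<in> D" for d
      using sum_flip[OF D that] True half_set_0[OF D] that by (auto simp: level_def mem_flip)
    then have "n 1 = card D" unfolding n_def by (metis (mono_tags, lifting) Collect_cong Collect_mem_eq)
    then show ?thesis
      using total j' True by (auto simp: card_half_set[OF D] level_def quotient_def)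
  next
    case s: False
    have n1: "n 1 = (if breaks D (\<Sum>D) = {} then 0 else 6)"
      unfolding n_def by (rule card_level_1_neighbours[OF D s])
    show ?thesis
    proof (cases "- \<Sum>D \<in> D")
      case True
      have "breaks D (\<Sum>D) \<noteq> {}"
      proof
        assume br: "breaks D (\<Sum>D) = {}"
        obtain b c where "frame (\<Sum>D) b c" using obtain_frame[OF s] .
        then interpret framed_half_set ty D "\<Sum>D" b c by unfold_locales (use D in auto)
        show False using mem_if_breaks_empty[OF br] True half_set_uminus[OF D s] by blast
      qed
      moreover have "n 3 = 0"
        using no_level_3_next_to_level_1[OF D _ True] by (auto simp: n_def)
      ultimately show ?thesis
        using total j' s True n0 n1 by (auto simp: level_def quotient_def)
    next
      case False
      then have "\<Sum>D \<in> D" using half_set_uminus[OF D s] by blast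
      then have "n 3 = (if breaks D (\<Sum>D) = {} then 4 else 1)"
        unfolding n_def by (rule card_level_3_neighbours[OF D])
      then show ?thesis
        using total j' s False n0 n1
        by (cases "breaks D (\<Sum>D) = {}") (auto simp: level_def quotient_def)
    qed
  qed
  then show ?thesis by (simp add: n_def)
qed

end

section \<open>Words of full weight\<close>

definition scaled_column :: "'a::field ^ 'n ^ 'm \<Rightarrow> 'a ^ 'n \<Rightarrow> 'n \<Rightarrow> 'a ^ 'm" where
  "scaled_column A x j = x $ j *s column j A"

definition scaled_columns :: "'a::field ^ 'n ^ 'm \<Rightarrow> 'a ^ 'n \<Rightarrow> ('a ^ 'm) set" where
  "scaled_columns A x = range (scaled_column A x)"

definition negate_at :: "'n \<Rightarrow> 'a::field ^ 'n \<Rightarrow> 'a ^ 'n" where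
  "negate_at j x = (\<chi> i. if i = j then - x $ i else x $ i)"

lemma weight_full_iff: "weight (x :: 'a::zero ^ 13) = 13 \<longleftrightarrow> (\<forall>i. x $ i \<noteq> 0)"
proof -
  have "weight x = 13 \<longleftrightarrow> {i. x $ i \<noteq> 0} = UNIV"
    unfolding weight_def using card_subset_eq[of UNIV "{i. x $ i \<noteq> 0}"] by auto
  then show ?thesis by blast
qed

lemma span_scale_singleton: "x \<noteq> 0 \<Longrightarrow> vec.span {x *s v} = vec.span {v :: 'a::field ^ 'n}"
proof -
  assume "x \<noteq> 0"
  then have "v = inverse x *s (x *s v)" by simp
  then have "v \<in> vec.span {x *s v}" by (metis vec.span_base vec.span_scale singletonI)
  then show ?thesis
    by (simp add: vec.span_eq vec.span_base vec.span_scale)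
qed

context ternary_field
begin

lemma scaled_column_unique:
  fixes A :: "'a ^ 'n ^ 'm"
  assumes A: "hamming_parity_check A" and x: "\<And>i. x $ i \<noteq> 0"
    and eq: "scaled_column A x i = scaled_column A x j \<or> scaled_column A x i = - scaled_column A x j"
  shows "i = j"
proof -
  have span: "vec.span {y *s scaled_column A x i} = vec.span {column i A}" if "y \<noteq> 0" for i y
    using that x[of i] span_scale_singleton[of "y * x $ i" "column i A"] by (simp add: scaled_column_def)
  have "scaled_column A x i = 1 *s scaled_column A x j \<or> scaled_column A x i = (-1) *s scaled_column A x j"
    using eq by (simp add: vec.scale_minus_left)
  then have "vec.span {1 *s scaled_column A x i} = vec.span {column j A}"
    using span[of 1 j] span[of "-1" j] by auto
  then have "vec.span {column i A} = vec.span {column j A}" using span[of 1 i] by simp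
  then show ?thesis using A unfolding hamming_parity_check_def bij_betw_def inj_def by blast
qed

text \<open>The line spanned by a nonzero \<open>v\<close> is spanned by a unique column, and over the field with three elements
  the scaled column is \<open>v\<close> or \<open>-v\<close>.\<close>

lemma half_set_scaled_columns:
  fixes A :: "'a ^ 'n ^ 3"
  assumes A: "hamming_parity_check A" and x: "\<And>i. x $ i \<noteq> 0"
  shows "half_set (scaled_columns A x)"
proof -
  have col: "column j A \<noteq> 0" for j
  proof
    assume "column j A = 0"
    moreover have "vec.dim (vec.span {column j A}) = 1"
      using A unfolding hamming_parity_check_def bij_betw_def by blast
    ultimately show False by simp
  qed
  then have nz: "scaled_column A x j \<noteq> 0" for j using x by (simp add: scaled_column_def)
  have "-v \<in> scaled_columns A x \<longleftrightarrow> v \<notin> scaled_columns A x" if v: "v \<noteq> 0" for v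
  proof -
    have "vec.span {v} \<in> {U. vec.subspace U \<and> vec.dim U = 1}" using v by simp
    then obtain j where "vec.span {v} = vec.span {column j A}"
      using A unfolding hamming_parity_check_def bij_betw_def by (metis (no_types, lifting) imageE)
    then have "v \<in> vec.span {column j A}" using vec.span_base[of v "{v}"] by simp
    then obtain y where y: "v = y *s column j A" by (auto simp: vec.span_breakdown_eq)
    have "v = scaled_column A x j \<or> v = - scaled_column A x j"
      using F3_cases[of y] F3_cases[of "x $ j"] x[of j] v y by (auto simp: scaled_column_def vec.scale_minus_left)
    moreover have "- scaled_column A x j \<notin> scaled_columns A x"
    proof
      assume "- scaled_column A x j \<in> scaled_columns A x"
      then obtain i where i: "scaled_column A x i = - scaled_column A x j"
        unfolding scaled_columns_def by auto
      then have "i = j" by (intro scaled_column_unique[OF A x]) simp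
      then show False using i nz eq_uminus_iff[of "scaled_column A x j"] by simp
    qed
    ultimately show ?thesis unfolding scaled_columns_def by auto
  qed
  then show ?thesis using nz unfolding half_set_def scaled_columns_def by auto
qed

lemma inj_scaled_column:
  fixes A :: "'a ^ 'n ^ 'm"
  assumes "hamming_parity_check A" "\<And>i. x $ i \<noteq> 0"
  shows "inj (scaled_column A x)"
  using scaled_column_unique[OF assms] by (auto intro!: injI)

lemma sum_scaled_columns:
  fixes A :: "'a ^ 'n ^ 'm"
  assumes "hamming_parity_check A" "\<And>i. x $ i \<noteq> 0"
  shows "\<Sum>(scaled_columns A x) = A *v x"
  unfolding scaled_columns_def matrix_mult_sum
  by (subst sum.reindex[OF inj_scaled_column[OF assms]]) (simp add: scaled_column_def)

lemma scaled_columns_negate_at: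
  fixes A :: "'a ^ 'n ^ 'm"
  assumes "hamming_parity_check A" "\<And>i. x $ i \<noteq> 0"
  shows "scaled_columns A (negate_at j x) = flip (scaled_column A x j) (scaled_columns A x)"
proof -
  have "scaled_column A (negate_at j x) i =
      (if i = j then - scaled_column A x j else scaled_column A x i)" for i
    by (simp add: scaled_column_def negate_at_def vec.scale_minus_left)
  then have "scaled_columns A (negate_at j x) = insert (- scaled_column A x j) (scaled_column A x ` (UNIV - {j}))"
    unfolding scaled_columns_def by auto
  also have "scaled_column A x ` (UNIV - {j}) = scaled_columns A x - {scaled_column A x j}"
    unfolding scaled_columns_def using inj_scaled_column[OF assms] by (simp add: image_set_diff)
  finally show ?thesis unfolding flip_def .
qed

text \<open>With only two nonzero values, changing a coordinate within the nonzero values negates it.\<close>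

lemma full_weight_neighbours:
  fixes x y :: "'a ^ 'n"
  assumes x: "\<And>i. x $ i \<noteq> 0"
  shows "(\<forall>i. y $ i \<noteq> 0) \<and> card {i. x $ i \<noteq> y $ i} = 1 \<longleftrightarrow> y \<in> range (\<lambda>j. negate_at j x)"
proof
  assume *: "(\<forall>i. y $ i \<noteq> 0) \<and> card {i. x $ i \<noteq> y $ i} = 1"
  then obtain j where j: "{i. x $ i \<noteq> y $ i} = {j}" by (metis card_1_singletonE)
  then have "x $ j \<noteq> y $ j" by blast
  then have "y $ j = - x $ j"
    using * x[of j] F3_cases[of "x $ j"] F3_cases[of "y $ j"] by auto
  moreover have "y $ i = x $ i" if "i \<noteq> j" for i
  proof -
    have "i \<notin> {i. x $ i \<noteq> y $ i}" unfolding j using that by simp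
    then show ?thesis by simp
  qed
  ultimately have "y = negate_at j x" by (simp add: vec_eq_iff negate_at_def)
  then show "y \<in> range (\<lambda>j. negate_at j x)" by blast
next
  assume "y \<in> range (\<lambda>j. negate_at j x)"
  then obtain j where y: "y = negate_at j x" by blast
  have "x $ j \<noteq> - x $ j" using x[of j] F3_cases[of "x $ j"] F3_simps by auto
  then have "{i. x $ i \<noteq> y $ i} = {j}" by (auto simp: y negate_at_def)
  moreover have "\<forall>i. y $ i \<noteq> 0" using x by (simp add: y negate_at_def)
  ultimately show "(\<forall>i. y $ i \<noteq> 0) \<and> card {i. x $ i \<noteq> y $ i} = 1" by simp
qed

lemma inj_negate_at:
  fixes x :: "'a ^ 'n"
  assumes x: "\<And>i. x $ i \<noteq> 0"
  shows "inj (\<lambda>j. negate_at j x)"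
proof (rule injI)
  fix i j assume "negate_at i x = negate_at j x"
  then have "negate_at i x $ i = negate_at j x $ i" by simp
  then show "i = j" using x[of i] F3_cases[of "x $ i"] F3_simps by (auto simp: negate_at_def split: if_splits)
qed

lemma card_neighbours_with_level:
  fixes A :: "'a ^ 'n ^ 3"
  assumes A: "hamming_parity_check A" and x: "\<And>i. x $ i \<noteq> 0" and l: "l \<le> 3"
  shows "card {y. (\<forall>i. y $ i \<noteq> 0) \<and> level (scaled_columns A y) = l \<and> card {i. x $ i \<noteq> y $ i} = 1}
    = quotient (level (scaled_columns A x)) l"
proof -
  let ?D = "scaled_columns A x" and ?d = "scaled_column A x"
  let ?J = "{j. level (flip (?d j) ?D) = l}"
  have "{y. (\<forall>i. y $ i \<noteq> 0) \<and> level (scaled_columns A y) = l \<and> card {i. x $ i \<noteq> y $ i} = 1}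
      = (\<lambda>j. negate_at j x) ` ?J"
    using full_weight_neighbours[OF x] scaled_columns_negate_at[OF A x] by fastforce
  then have "card {y. (\<forall>i. y $ i \<noteq> 0) \<and> level (scaled_columns A y) = l \<and> card {i. x $ i \<noteq> y $ i} = 1} = card ?J"
    using inj_negate_at[OF x] by (simp add: card_image inj_on_subset)
  also have "\<dots> = card (?d ` ?J)"
    using inj_scaled_column[OF A x] by (metis card_image inj_on_subset subset_UNIV)
  also have "?d ` ?J = {d \<in> ?D. level (flip d ?D) = l}"
    unfolding scaled_columns_def by auto
  also have "card \<dots> = quotient (level ?D) l"
    by (rule card_level_neighbours[OF half_set_scaled_columns[OF A x] l])
  finally show ?thesis .
qed

lemma full_weight_graph_isomorphic_binary:
  assumes "W = {x :: 'a ^ 'n. \<forall>i. x $ i \<noteq> 0}"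
  shows "graph_isomorphic (induced_subgraph hamming_graph W) (hamming_graph :: (bool ^ 'n) graph)"
proof -
  define f where "f x = (\<chi> i. x $ i = 1)" for x :: "'a ^ 'n"
  let ?G = "induced_subgraph hamming_graph W"
  have V: "verts ?G = W" by (simp add: induced_subgraph_def hamming_graph_def)
  have W: "x $ i = 1 \<or> x $ i = -1" if "x \<in> W" for x i
    using that F3_cases[of "x $ i"] by (auto simp: assms)
  have f_eq: "f u $ i = f v $ i \<longleftrightarrow> u $ i = v $ i" if "u \<in> W" "v \<in> W" for u v i
    using W[OF that(1), of i] W[OF that(2), of i] F3_simps by (auto simp: f_def)
  have "bij_betw f (verts ?G) (verts (hamming_graph :: (bool ^ 'n) graph))"
    unfolding V
  proof (rule bij_betw_imageI)
    show "inj_on f W" using f_eq by (auto simp: inj_on_def vec_eq_iff)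
    have "z \<in> f ` W" for z
    proof
      let ?x = "(\<chi> i. if z $ i then 1 else -1) :: 'a ^ 'n"
      show "z = f ?x" using F3_simps by (simp add: f_def vec_eq_iff)
      show "?x \<in> W" by (simp add: assms)
    qed
    then show "f ` W = verts (hamming_graph :: (bool ^ 'n) graph)"
      by (auto simp: hamming_graph_def)
  qed
  moreover have "(u, v) \<in> adj ?G \<longleftrightarrow> (f u, f v) \<in> adj (hamming_graph :: (bool ^ 'n) graph)"
    if "u \<in> verts ?G" "v \<in> verts ?G" for u v
  proof -
    have "(f u, f v) \<in> adj (hamming_graph :: (bool ^ 'n) graph) \<longleftrightarrow> card {i. f u $ i \<noteq> f v $ i} = 1"
      by (simp add: hamming_graph_def)
    also have "{i. f u $ i \<noteq> f v $ i} = {i. u $ i \<noteq> v $ i}"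
      using that f_eq[of u v] unfolding V by blast
    finally show ?thesis
      using that unfolding V by (simp add: induced_subgraph_def hamming_graph_def)
  qed
  ultimately show ?thesis unfolding graph_isomorphic_def by blast
qed

end

theorem theorem1:
  fixes A :: "'a::field ^ 13 ^ 3"
    and \<H> :: "('a ^ 13) set"
    and G :: "('a ^ 13) graph"
    and C :: "('a ^ 13) set"
  assumes "CARD('a) = 3"
    and "hamming_parity_check A"
    and "\<H> = code_of_parity_check A"
    and "G = induced_subgraph hamming_graph {x. weight x = 13}"
    and "C = {x \<in> \<H>. weight x = 13}"
  shows "completely_regular_code G C \<and>
         has_intersection_array G C [13, 6, 1] [1, 6, 9] \<and>
         graph_isomorphic G (hamming_graph :: (bool ^ 13) graph)"
proof -
  interpret ternary_field "TYPE('a)" by unfold_locales (rule assms(1))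
  note A = assms(2)
  define W where "W = {x :: 'a ^ 13. \<forall>i. x $ i \<noteq> 0}"
  define r where "r x = level (scaled_columns A x)" for x
  have G: "G = induced_subgraph hamming_graph W"
    using assms(4) by (simp add: W_def weight_full_iff)
  have V: "verts G = W" and E: "adj G = {(x, y). card {i. x $ i \<noteq> y $ i} = 1} \<inter> W \<times> W"
    by (simp_all add: G induced_subgraph_def hamming_graph_def)
  have "finite (UNIV :: ('a ^ 13) set)"
    by (rule card_ge_0_finite) (simp add: card3)
  then have fin: "finite (verts G)" by (rule rev_finite_subset) simp
  have ne: "verts G \<noteq> {}"
  proof -
    have "(\<chi> i. 1) \<in> W" by (simp add: W_def)
    then show ?thesis unfolding V by blast
  qed
  have sym: "sym (adj G)" unfolding E by (auto intro!: symI simp: eq_commute)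
  have nbrs: "card {w \<in> verts G. r w = j \<and> (v, w) \<in> adj G} = quotient (r v) j"
    if "v \<in> verts G" "j \<le> 3" for v j
  proof -
    have v: "\<And>i. v $ i \<noteq> 0" and vW: "v \<in> W" using that(1) by (simp_all add: V W_def)
    have "{w \<in> verts G. r w = j \<and> (v, w) \<in> adj G} =
        {w. (\<forall>i. w $ i \<noteq> 0) \<and> level (scaled_columns A w) = j \<and> card {i. v $ i \<noteq> w $ i} = 1}"
      unfolding V E using vW by (auto simp: W_def r_def)
    then show ?thesis
      using card_neighbours_with_level[OF A v that(2)] by (simp add: r_def)
  qed
  have C: "C = {v \<in> verts G. r v = 0}"
    using assms(3,5) sum_scaled_columns[OF A]
    by (auto simp: V W_def weight_full_iff code_of_parity_check_def r_def level_def split: if_splits)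
  have le3: "i = 0 \<or> i = 1 \<or> i = 2 \<or> i = 3" if "i \<le> 3" for i :: nat using that by auto
  have far: "quotient i j = 0" if "i \<le> 3" "j \<le> 3" "Suc i < j" for i j
    using le3[OF that(1)] le3[OF that(2)] that(3) by (auto simp: quotient_def)
  have up: "quotient i (Suc i) \<noteq> 0" and down: "quotient (Suc i) i \<noteq> 0" if "i < 3" for i
    using le3[of i] that by (auto simp: quotient_def)
  have adj: "adj G \<subseteq> verts G \<times> verts G" by (auto simp: E V)
  have r_le: "r v \<le> 3" for v unfolding r_def by (rule level_le)
  note crc = tridiagonal_equitable_partition_is_distance_partition[of G r 3 quotient C,
      OF fin ne adj sym r_le nbrs far up down C]
  have "map (\<lambda>i. quotient i (i + 1)) [0..<3] = [13, 6, 1]"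
    and "map (\<lambda>i. quotient i (i - 1)) [1..<3 + 1] = [1, 6, 9]"
    by (simp_all add: quotient_def upt_rec)
  then show ?thesis
    using crc full_weight_graph_isomorphic_binary[OF W_def] by (simp add: G)
qed

end
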